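(* For $n\ge 6$ let $L_n:=\sum_{T\in\mathcal{T}(P_n^4)}|\mathcal{L}(T)|$ be the total number of leaves over all spanning trees of the fourth power $P_n^4$ of the path on $n$ vertices. Then there is a polynomial $M_4$ in $t$ of degree $29$ such that, as formal power series, $$\sum_{m=0}^{\infty} L_{m+6}\,t^m=\frac{M_4}{(t^6 - 3t^5 + 6t^4 - 10t^3 + 6t^2 - 3t + 1)^2(t^8 - 4t^7 - 17t^6 + 8t^5 + 49t^4 + 8t^3 - 17t^2 - 4t + 1)^2}.$$
   Context: All graphs are finite and simple. $P_n$ is the path graph on $n$ vertices. For a graph $G$ and $k\ge1$, the $k$-th power $G^k$ has $V(G^k)=V(G)$, and $uv$ is an edge iff the distance between $u$ and $v$ in $G$ is at least $1$ and at most $k$. $\mathcal{T}(G)$ is the set of labeled spanning trees of $G$ (isomorphic trees with different labels are different). $\mathcal{L}(T)$ is the set of leaves (vertices of degree exactly $1$ in $T$) of $T$. The family is $\mathcal{P}_k=\{P_n^k : k<\operatorname{diam} P_n\}=\{P_n^k : n\ge k+2\}$, here with $k=4$; the sequence is indexed so that the constant term of the generating function corresponds to the smallest member $n=k+2$. *)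

theory Defs
  imports
    "HOL-Computational_Algebra.Polynomial_FPS"
    "HOL-Library.Extended_Nat"
begin

text \<open>
  Finite simple graphs: an edge is the two-element set of its end points.  Two spanning trees
  are equal only if they have the same edge set, so they are counted as labelled trees.
\<close>

record 'a sgraph =
  verts :: "'a set"
  edges :: "'a set set"

definition simple_graph :: "'a sgraph \<Rightarrow> bool" where
  "simple_graph G \<longleftrightarrow> finite (verts G) \<and> (\<forall>e\<in>edges G. e \<subseteq> verts G \<and> card e = 2)"

text \<open>Walks are given by their nonempty sequence of vertices.\<close>

definition walk :: "'a sgraph \<Rightarrow> 'a list \<Rightarrow> bool" where
  "walk G p \<longleftrightarrow> p \<noteq> [] \<and> set p \<subseteq> verts G \<and>
     (\<forall>i. Suc i < length p \<longrightarrow> {p ! i, p ! Suc i} \<in> edges G)"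

definition walk_betw :: "'a sgraph \<Rightarrow> 'a \<Rightarrow> 'a list \<Rightarrow> 'a \<Rightarrow> bool" where
  "walk_betw G u p v \<longleftrightarrow> walk G p \<and> hd p = u \<and> last p = v"

text \<open>
  The length of a walk is its number of edges.  If no walk joins \<open>u\<close> and \<open>v\<close>, the infimum
  is over the empty set and the distance is \<open>\<infinity>\<close>.
\<close>

definition graph_dist :: "'a sgraph \<Rightarrow> 'a \<Rightarrow> 'a \<Rightarrow> enat" where
  "graph_dist G u v = (INF p\<in>{p. walk_betw G u p v}. enat (length p - 1))"

definition graph_power :: "'a sgraph \<Rightarrow> nat \<Rightarrow> 'a sgraph" where
  "graph_power G k =
     \<lparr>verts = verts G,
      edges = {{u, v} | u v. u \<in> verts G \<and> v \<in> verts G \<and>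
                 1 \<le> graph_dist G u v \<and> graph_dist G u v \<le> enat k}\<rparr>"

definition path_graph :: "nat \<Rightarrow> nat sgraph" where
  "path_graph n = \<lparr>verts = {1..n}, edges = {{i, Suc i} | i. 1 \<le> i \<and> i < n}\<rparr>"

definition connected_graph :: "'a sgraph \<Rightarrow> bool" where
  "connected_graph G \<longleftrightarrow>
     verts G \<noteq> {} \<and> (\<forall>u\<in>verts G. \<forall>v\<in>verts G. \<exists>p. walk_betw G u p v)"

text \<open>The vertices of a cycle are listed once each; the closing edge joins the last to the first.\<close>

definition cycle :: "'a sgraph \<Rightarrow> 'a list \<Rightarrow> bool" where
  "cycle G c \<longleftrightarrow> walk G c \<and> distinct c \<and> 3 \<le> length c \<and> {last c, hd c} \<in> edges G"

definition tree :: "'a sgraph \<Rightarrow> bool" where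
  "tree T \<longleftrightarrow> simple_graph T \<and> connected_graph T \<and> (\<nexists>c. cycle T c)"

definition spanning_trees :: "'a sgraph \<Rightarrow> 'a sgraph set" where
  "spanning_trees G = {T. tree T \<and> verts T = verts G \<and> edges T \<subseteq> edges G}"

definition vert_degree :: "'a sgraph \<Rightarrow> 'a \<Rightarrow> nat" where
  "vert_degree G v = card {e \<in> edges G. v \<in> e}"

definition leaves :: "'a sgraph \<Rightarrow> 'a set" where
  "leaves T = {v \<in> verts T. vert_degree T v = 1}"

definition total_leaves :: "'a sgraph \<Rightarrow> nat" where
  "total_leaves G = (\<Sum>T\<in>spanning_trees G. card (leaves T))"

text \<open>
  The sum in \<open>total_leaves\<close> ranges over a finite set for every finite simple graph, and the
  powers of paths are such graphs.
\<close>

lemma finite_spanning_trees: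
  assumes "simple_graph G"
  shows "finite (spanning_trees G)"
proof -
  have "edges G \<subseteq> Pow (verts G)" "finite (verts G)"
    using assms by (auto simp: simple_graph_def)
  then have fin: "finite (edges G)"
    by (meson finite_Pow_iff finite_subset)
  have "spanning_trees G \<subseteq> (\<lambda>E. \<lparr>verts = verts G, edges = E\<rparr>) ` Pow (edges G)"
  proof
    fix T assume "T \<in> spanning_trees G"
    then have "T = \<lparr>verts = verts G, edges = edges T\<rparr>" "edges T \<in> Pow (edges G)"
      by (auto simp: spanning_trees_def)
    then show "T \<in> (\<lambda>E. \<lparr>verts = verts G, edges = E\<rparr>) ` Pow (edges G)"
      by blast
  qed
  with fin show ?thesis
    by (meson finite_Pow_iff finite_imageI finite_subset)
qed

lemma simple_graph_path_graph: "simple_graph (path_graph n)"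
  by (auto simp: simple_graph_def path_graph_def)

lemma graph_dist_self:
  assumes "u \<in> verts G"
  shows "graph_dist G u u = 0"
proof -
  have "walk_betw G u [u] u"
    using assms by (simp add: walk_betw_def walk_def)
  then have "graph_dist G u u \<le> enat (length [u] - 1)"
    unfolding graph_dist_def by (intro INF_lower) simp
  then show ?thesis
    by (simp add: zero_enat_def [symmetric])
qed

lemma simple_graph_graph_power:
  assumes "simple_graph G"
  shows "simple_graph (graph_power G k)"
  using assms by (auto simp: simple_graph_def graph_power_def graph_dist_self card_2_iff)
    (metis graph_dist_self not_one_le_zero)

end

theory Submission
  imports Defs
begin

unbundle fps_syntax

text \<open>
  A spanning tree \<open>T\<close> of a graph \<open>G\<close> in which \<open>v\<close> is a leaf is a spanning tree of \<open>G - v\<close>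
  together with one edge at \<open>v\<close>.  Hence the total number of leaves is the sum over all vertices
  of \<open>deg v\<close> times the number of spanning trees of \<open>G - v\<close> (\<open>total_leaves_eq\<close>), and it is
  enough to count spanning trees of the fourth power of a path with one vertex deleted.

  These are counted by adding the vertices in their natural order.  Later edges only reach the
  last four vertices, so all that a forest on the earlier vertices tells the future is the
  partition of these four into connected components; the number of ways to complete the forest
  to a spanning tree is a function of that partition (\<open>card_completions\<close>).  Far from the ends
  and from \<open>v\<close> a new vertex always acts by the same matrix on the fifteen partitions of four
  vertices, so the counts are entries of products of powers of this matrix.

  Let \<open>Q\<close> be the product of the two polynomials whose squares form the denominator.  It has
  degree 14 and is palindromic.  The matrix is annihilated by \<open>Q\<close> except for a rank one error
  along a left eigenvector for the eigenvalue 1, and this eigenvector is orthogonal to every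
  vector of counts that occurs: it expresses a linear relation between the numbers of
  completions of the fifteen partitions.  So the counts satisfy the recurrence \<open>Q\<close>
  (\<open>recurrence_col\<close>, \<open>recurrence_row\<close>).

  For \<open>n \<ge> 8\<close> let \<open>v\<close> run over the path.  The four vertices at either end give a
  sequence that satisfies the recurrence \<open>Q\<close>, which contributes the denominator \<open>Q\<close> only.
  All the others have degree 8, and there the count depends on the numbers \<open>i\<close> and \<open>j\<close> of
  full steps before and after the hole, with the recurrence \<open>Q\<close> in both variables.  Summing
  over \<open>i + j = n - 9\<close> produces the denominator \<open>Q\<^sup>2\<close> (\<open>annihilated_double\<close>).

  The exact degree is a matter of the first terms.  With \<open>B\<close> and \<open>C\<close> the series of the two
  parts, the generating function is \<open>L\<^sub>6 + L\<^sub>7 t + t\<^sup>2 B + 8 t\<^sup>3 C\<close>.  Multiplied by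
  \<open>Q\<^sup>2\<close>, each of its parts has degree at most 29, and the coefficient at 29 is
  \<open>18360 - 16344 + 0 = 2016\<close> (\<open>leading_coefficient\<close>).
\<close>

section \<open>Connectivity, forests and trees as edge sets\<close>

definition conn :: "'a set set \<Rightarrow> ('a \<times> 'a) set" where
  "conn E = {(a, b). {a, b} \<in> E}\<^sup>*"

text \<open>
  Every edge is a bridge.  This form makes the insertion of an edge (\<open>forest_insert\<close>) a
  statement about connectivity alone; \<open>cycle_iff_not_forest\<close> links it to cycles given as lists.
\<close>

definition forest :: "'a set set \<Rightarrow> bool" where
  "forest E \<longleftrightarrow> (\<forall>a b. {a, b} \<in> E \<longrightarrow> (a, b) \<notin> conn (E - {{a, b}}))"

definition tree_on :: "'a set \<Rightarrow> 'a set set \<Rightarrow> bool" where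
  "tree_on V E \<longleftrightarrow> forest E \<and> V \<times> V \<subseteq> conn E"

lemma conn_refl [simp]: "(a, a) \<in> conn E"
  by (simp add: conn_def)

lemma conn_edge: "{a, b} \<in> E \<Longrightarrow> (a, b) \<in> conn E"
  by (auto simp: conn_def)

lemma conn_sym: "(a, b) \<in> conn E \<Longrightarrow> (b, a) \<in> conn E"
proof -
  have "sym (conn E)"
    unfolding conn_def by (rule sym_rtrancl) (auto simp: sym_def insert_commute)
  then show "(a, b) \<in> conn E \<Longrightarrow> (b, a) \<in> conn E" by (rule symD)
qed

lemma conn_commute: "(a, b) \<in> conn E \<longleftrightarrow> (b, a) \<in> conn E"
  by (metis conn_sym)

lemma conn_trans: "(a, b) \<in> conn E \<Longrightarrow> (b, c) \<in> conn E \<Longrightarrow> (a, c) \<in> conn E"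
  by (auto simp: conn_def)

lemma conn_mono: "E \<subseteq> E' \<Longrightarrow> conn E \<subseteq> conn E'"
  unfolding conn_def by (rule rtrancl_mono) auto

text \<open>
  A walk that uses the new edge can be cut at its first and last use of it.
\<close>

lemma conn_insert:
  "(x, y) \<in> conn (insert {a, b} E) \<longleftrightarrow>
     (x, y) \<in> conn E \<or> (x, a) \<in> conn E \<and> (b, y) \<in> conn E
                     \<or> (x, b) \<in> conn E \<and> (a, y) \<in> conn E"
    (is "?L \<longleftrightarrow> ?R y")
proof
  assume ?L
  then have "(x, y) \<in> {(u, v). {u, v} \<in> insert {a, b} E}\<^sup>*"
    by (simp add: conn_def)
  then show "?R y"
  proof (induction rule: rtrancl_induct)
    case base
    then show ?case by simp
  next
    case (step y z)
    then consider "{y, z} \<in> E" | "y = a" "z = b" | "y = b" "z = a"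
      by (auto simp: doubleton_eq_iff)
    then show ?case
    proof cases
      case 1
      then show ?thesis using step.IH conn_trans conn_edge by meson
    next
      case 2
      then show ?thesis using step.IH by (metis conn_refl conn_trans conn_sym)
    next
      case 3
      then show ?thesis using step.IH by (metis conn_refl conn_trans conn_sym)
    qed
  qed
next
  assume "?R y"
  moreover have "(a, b) \<in> conn (insert {a, b} E)" by (simp add: conn_edge)
  moreover have "(u, v) \<in> conn E \<Longrightarrow> (u, v) \<in> conn (insert {a, b} E)" for u v
    using conn_mono[of E "insert {a, b} E"] by auto
  ultimately show ?L by (metis conn_trans conn_sym)
qed

lemma conn_isolated:
  assumes "(x, y) \<in> conn E" "\<And>a b. {a, b} \<in> E \<Longrightarrow> a \<in> C \<Longrightarrow> b \<in> C" "x \<in> C"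
  shows "y \<in> C"
  using assms(1) unfolding conn_def
proof (induction rule: rtrancl_induct)
  case (step y z)
  with assms(2)[of y z] show ?case by auto
qed (rule assms(3))

lemma conn_outside:
  assumes "(x, y) \<in> conn E" "x \<notin> \<Union>E"
  shows "y = x"
  using conn_isolated[OF assms(1), of "{x}"] assms(2) by blast

lemma forest_mono: "forest E' \<Longrightarrow> E \<subseteq> E' \<Longrightarrow> forest E"
  unfolding forest_def by (meson Diff_mono conn_mono subset_iff order_refl)

lemma forest_insert:
  assumes "{a, b} \<notin> E"
  shows "forest (insert {a, b} E) \<longleftrightarrow> forest E \<and> (a, b) \<notin> conn E"
proof (intro iffI conjI)
  assume f: "forest (insert {a, b} E)"
  then show "forest E" by (rule forest_mono) auto
  show "(a, b) \<notin> conn E"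
    using f[unfolded forest_def, rule_format, of a b] assms by simp
next
  assume as: "forest E \<and> (a, b) \<notin> conn E"
  show "forest (insert {a, b} E)"
    unfolding forest_def
  proof (intro allI impI notI)
    fix c d assume cd: "{c, d} \<in> insert {a, b} E"
      and con: "(c, d) \<in> conn (insert {a, b} E - {{c, d}})"
    show False
    proof (cases "{c, d} = {a, b}")
      case True
      then have "(c, d) \<in> conn E"
        using con assms by simp
      then have "(a, b) \<in> conn E" using True by (metis conn_sym doubleton_eq_iff)
      then show False using as by simp
    next
      case False
      then have E: "{c, d} \<in> E" and
        con': "(c, d) \<in> conn (insert {a, b} (E - {{c, d}}))"
        using cd con by (auto simp: insert_Diff_if)
      have "(u, v) \<in> conn (E - {{c, d}}) \<Longrightarrow> (u, v) \<in> conn E" for u v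
        using conn_mono[of "E - {{c, d}}" E] by auto
      moreover have "(c, d) \<notin> conn (E - {{c, d}})" "(c, d) \<in> conn E"
        using as E by (auto simp: forest_def conn_edge)
      ultimately show False
        using con'[unfolded conn_insert] as by (meson conn_sym conn_trans)
    qed
  qed
qed

lemma walk_iff: "walk G p \<longleftrightarrow> p \<noteq> [] \<and> set p \<subseteq> verts G \<and> successively (\<lambda>a b. {a, b} \<in> edges G) p"
  by (auto simp: walk_def successively_conv_nth)

lemma successively_conn:
  assumes "successively (\<lambda>a b. {a, b} \<in> E) p" "p \<noteq> []"
  shows "(hd p, last p) \<in> conn E"
  using assms
proof (induction p rule: induct_list012)
  case (3 x y zs)
  then show ?case using conn_trans[OF conn_edge[of x y E]] by auto
qed auto

text \<open>
  Walks are extended by one edge at a time; when the new end already occurs, the walk is cut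
  there, which keeps its vertices distinct.
\<close>

lemma conn_imp_path:
  assumes "(a, b) \<in> conn E"
  shows "\<exists>p. p \<noteq> [] \<and> successively (\<lambda>a b. {a, b} \<in> E) p \<and> distinct p \<and> hd p = a \<and> last p = b
    \<and> set p \<subseteq> insert a (\<Union>E)"
  using assms unfolding conn_def
proof (induction rule: rtrancl_induct)
  case base
  then show ?case by (intro exI[of _ "[a]"]) auto
next
  case (step y z)
  then obtain p where p: "p \<noteq> []" "successively (\<lambda>a b. {a, b} \<in> E) p" "distinct p"
    "hd p = a" "last p = y" "set p \<subseteq> insert a (\<Union>E)" by blast
  show ?case
  proof (cases "z \<in> set p")
    case True
    then obtain p1 p2 where "p = (p1 @ [z]) @ p2" by (auto dest: split_list)
    then show ?thesis using p
      by (intro exI[of _ "p1 @ [z]"]) (auto simp: successively_append_iff hd_append)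
  next
    case False
    then show ?thesis using p step.hyps(2)
      by (intro exI[of _ "p @ [z]"]) (auto simp: successively_append_iff hd_append)
  qed
qed

lemma connected_graph_iff:
  assumes "\<And>e. e \<in> edges G \<Longrightarrow> e \<subseteq> verts G"
  shows "connected_graph G \<longleftrightarrow> verts G \<noteq> {} \<and> verts G \<times> verts G \<subseteq> conn (edges G)"
proof -
  have "(\<exists>p. walk_betw G u p v) \<longleftrightarrow> (u, v) \<in> conn (edges G)" if "u \<in> verts G" for u v
  proof
    assume "\<exists>p. walk_betw G u p v"
    then show "(u, v) \<in> conn (edges G)"
      using successively_conn by (force simp: walk_betw_def walk_iff)
  next
    assume "(u, v) \<in> conn (edges G)"
    from conn_imp_path[OF this] obtain p where
      "p \<noteq> []" "successively (\<lambda>a b. {a, b} \<in> edges G) p" "hd p = u" "last p = v"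
      "set p \<subseteq> insert u (\<Union>(edges G))" by blast
    moreover from this have "set p \<subseteq> verts G" using that assms by blast
    ultimately show "\<exists>p. walk_betw G u p v"
      by (auto simp: walk_betw_def walk_iff)
  qed
  then show ?thesis unfolding connected_graph_def by auto
qed

text \<open>
  The closing edge of a cycle is not a bridge, since the rest of the cycle still joins its
  ends.  Conversely, a path that avoids an edge but joins its ends has at least three vertices
  and is closed to a cycle by that edge.
\<close>

lemma cycle_iff_not_forest:
  assumes "simple_graph G"
  shows "(\<exists>c. cycle G c) \<longleftrightarrow> \<not> forest (edges G)"
proof
  assume "\<exists>c. cycle G c"
  then obtain c where c: "walk G c" "distinct c" "3 \<le> length c" "{last c, hd c} \<in> edges G"
    by (auto simp: cycle_def)
  let ?e = "{last c, hd c}"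
  have "successively (\<lambda>a b. {a, b} \<in> edges G - {?e}) c"
    unfolding successively_conv_nth
  proof (intro allI impI)
    fix i assume i: "Suc i < length c"
    have "{c ! i, c ! Suc i} \<noteq> {c ! (length c - 1), c ! 0}"
    proof -
      have idx: "c ! j = c ! l \<longleftrightarrow> j = l" if "j < length c" "l < length c" for j l
        using nth_eq_iff_index_eq[OF c(2) that] .
      have L: "0 < length c" "length c - 1 < length c" using c(3) by auto
      show ?thesis
      proof
        assume "{c ! i, c ! Suc i} = {c ! (length c - 1), c ! 0}"
        then consider "c ! Suc i = c ! 0" | "c ! i = c ! 0" "c ! Suc i = c ! (length c - 1)"
          by (auto simp: doubleton_eq_iff)
        then show False
        proof cases
          case 1
          from idx[OF i L(1), THEN iffD1, OF 1] show False by simp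
        next
          case 2
          from idx[OF Suc_lessD[OF i] L(1), THEN iffD1, OF 2(1)]
            idx[OF i L(2), THEN iffD1, OF 2(2)] c(3) show False by simp
        qed
      qed
    qed
    then show "{c ! i, c ! Suc i} \<in> edges G - {?e}"
      using c(1) i by (auto simp: walk_def last_conv_nth hd_conv_nth)
  qed
  then have "(hd c, last c) \<in> conn (edges G - {?e})"
    using c(1) by (intro successively_conn) (auto simp: walk_def)
  then have "(last c, hd c) \<in> conn (edges G - {?e})" by (rule conn_sym)
  then show "\<not> forest (edges G)"
    using c(4) unfolding forest_def by blast
next
  assume "\<not> forest (edges G)"
  then obtain a b where ab: "{a, b} \<in> edges G" "(a, b) \<in> conn (edges G - {{a, b}})"
    by (auto simp: forest_def)
  from conn_imp_path[OF ab(2)] obtain p where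
    p: "p \<noteq> []" "successively (\<lambda>u v. {u, v} \<in> edges G - {{a, b}}) p" "distinct p"
      "hd p = a" "last p = b" "set p \<subseteq> insert a (\<Union>(edges G - {{a, b}}))" by blast
  have V: "e \<subseteq> verts G \<and> card e = 2" if "e \<in> edges G" for e
    using assms that by (auto simp: simple_graph_def)
  have "a \<noteq> b" using V[OF ab(1)] by auto
  have "3 \<le> length p"
  proof (rule ccontr)
    assume "\<not> 3 \<le> length p"
    with p(1) consider "\<exists>x. p = [x]" | "\<exists>x y. p = [x, y]"
      by (cases p; cases "tl p"; cases "tl (tl p)") auto
    then show False using p \<open>a \<noteq> b\<close> by cases auto
  qed
  moreover have "set p \<subseteq> verts G" using p(6) V ab(1) by blast
  moreover have "successively (\<lambda>u v. {u, v} \<in> edges G) p"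
    using p(2) by (rule successively_mono) auto
  ultimately have "cycle G p"
    using p ab(1) by (auto simp: cycle_def walk_iff insert_commute)
  then show "\<exists>c. cycle G c" by blast
qed

lemma spanning_trees_eq:
  assumes "simple_graph G" "verts G \<noteq> {}"
  shows "spanning_trees G =
    (\<lambda>F. \<lparr>verts = verts G, edges = F\<rparr>) ` {F. F \<subseteq> edges G \<and> tree_on (verts G) F}"
    (is "_ = ?f ` ?A")
proof -
  have "?f F \<in> spanning_trees G \<longleftrightarrow> F \<in> ?A" for F
  proof (cases "F \<subseteq> edges G")
    case True
    then have s: "simple_graph (?f F)" using assms(1) by (auto simp: simple_graph_def)
    then have "connected_graph (?f F) \<longleftrightarrow> verts G \<times> verts G \<subseteq> conn F"
      using assms(2) by (subst connected_graph_iff) (auto simp: simple_graph_def)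
    moreover have "(\<nexists>c. cycle (?f F) c) \<longleftrightarrow> forest F"
      using cycle_iff_not_forest[OF s] by simp
    ultimately show ?thesis using True s
      by (auto simp: spanning_trees_def tree_def tree_on_def)
  qed (auto simp: spanning_trees_def)
  note key = this
  show ?thesis
  proof (intro equalityI subsetI)
    fix T assume T: "T \<in> spanning_trees G"
    then have "T = ?f (edges T)" by (auto simp: spanning_trees_def)
    then obtain F where F: "T = ?f F" by blast
    with T have "F \<in> ?A" by (simp only: key)
    with F show "T \<in> ?f ` ?A" by (rule image_eqI)
  next
    fix T assume "T \<in> ?f ` ?A"
    then obtain F where "T = ?f F" "F \<in> ?A" by (rule imageE)
    then show "T \<in> spanning_trees G" by (simp only: key)
  qed
qed

text \<open>
  Removing the leaf \<open>v\<close> with its only edge is inverse to attaching \<open>v\<close> by any of its edges to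
  a tree on the other vertices, and the two choices are independent.
\<close>

lemma card_pendant_trees:
  fixes E :: "'a set set"
  assumes fin: "finite E" and E: "\<And>e. e \<in> E \<Longrightarrow> e \<subseteq> V \<and> card e = 2" and "v \<in> V"
  shows "card {F. F \<subseteq> E \<and> tree_on V F \<and> card {e \<in> F. v \<in> e} = 1} =
    card {e \<in> E. v \<in> e} * card {F. F \<subseteq> {e \<in> E. v \<notin> e} \<and> tree_on (V - {v}) F}"
    (is "card ?A = card ?D * card ?B")
proof -
  have key: "tree_on V (insert e F) \<longleftrightarrow> tree_on (V - {v}) F"
    if e: "e \<in> ?D" and F: "F \<subseteq> {e \<in> E. v \<notin> e}" for e F
  proof -
    from e E have "card e = 2" "v \<in> e" by auto
    then obtain u where u: "e = {v, u}" "u \<noteq> v"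
      by (auto simp: card_2_iff doubleton_eq_iff)
    with e E have "u \<in> V" by auto
    have vF: "(v, x) \<in> conn F \<longleftrightarrow> x = v" for x
      using F by (auto dest: conn_outside)
    have "e \<notin> F" using e F by auto
    then have "forest (insert e F) \<longleftrightarrow> forest F"
      unfolding u using vF[of u] u(2) forest_insert by metis
    moreover have "V \<times> V \<subseteq> conn (insert e F) \<longleftrightarrow> (V - {v}) \<times> (V - {v}) \<subseteq> conn F"
    proof (rule iffI)
      assume L: "V \<times> V \<subseteq> conn (insert e F)"
      show "(V - {v}) \<times> (V - {v}) \<subseteq> conn F"
      proof (rule subrelI)
        fix a b assume "(a, b) \<in> (V - {v}) \<times> (V - {v})"
        then have ab: "a \<in> V" "b \<in> V" "a \<noteq> v" "b \<noteq> v" by auto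
        then have "(a, b) \<in> conn (insert {v, u} F)" using L u by auto
        then show "(a, b) \<in> conn F"
          using vF[of a] vF[of b] ab conn_sym[of a v F]
          unfolding conn_insert by blast
      qed
    next
      assume R: "(V - {v}) \<times> (V - {v}) \<subseteq> conn F"
      have 1: "(a, b) \<in> conn (insert e F)" if "a \<in> V" "b \<in> V" "a \<noteq> v" "b \<noteq> v" for a b
        using R that conn_mono[of F "insert e F"] by blast
      have 2: "(v, a) \<in> conn (insert e F)" if "a \<in> V" for a
      proof (cases "a = v")
        case False
        have "(v, u) \<in> conn (insert e F)" by (simp add: u conn_edge)
        moreover have "(u, a) \<in> conn (insert e F)"
          using 1 False \<open>u \<in> V\<close> that u by auto
        ultimately show ?thesis by (rule conn_trans)
      qed simp
      show "V \<times> V \<subseteq> conn (insert e F)"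
        using 1 2 conn_sym by (metis SigmaE subsetI)
    qed
    ultimately show ?thesis by (simp add: tree_on_def)
  qed
  have "bij_betw (\<lambda>(e, F). insert e F) (?D \<times> ?B) ?A"
    unfolding bij_betw_def
  proof
    show "inj_on (\<lambda>(e, F). insert e F) (?D \<times> ?B)"
    proof (rule inj_onI, clarify)
      fix e F e' F'
      assume *: "v \<in> e" "v \<in> e'" "F \<subseteq> {e \<in> E. v \<notin> e}" "F' \<subseteq> {e \<in> E. v \<notin> e}"
        "insert e F = insert e' F'"
      have "{x \<in> insert e F. v \<in> x} = {e}" "{x \<in> insert e' F'. v \<in> x} = {e'}"
        "{x \<in> insert e F. v \<notin> x} = F" "{x \<in> insert e' F'. v \<notin> x} = F'"
        using *(1-4) by auto
      then show "e = e' \<and> F = F'" unfolding *(5) by (metis singleton_inject)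
    qed
    show "(\<lambda>(e, F). insert e F) ` (?D \<times> ?B) = ?A"
    proof (intro equalityI subsetI)
      fix X assume "X \<in> (\<lambda>(e, F). insert e F) ` (?D \<times> ?B)"
      then obtain e F where X: "X = insert e F" "e \<in> ?D" "F \<in> ?B" by auto
      from X(2,3) have "{x \<in> insert e F. v \<in> x} = {e}" by auto
      then show "X \<in> ?A" using X(2,3) key[of e F] unfolding X(1) by auto
    next
      fix X assume X: "X \<in> ?A"
      then obtain e where e: "{e \<in> X. v \<in> e} = {e}" by (auto simp: card_1_singleton_iff)
      define F where "F = X - {e}"
      have XF: "X = insert e F" using e F_def by auto
      have "F \<subseteq> {e \<in> E. v \<notin> e}" using e X F_def by auto
      moreover have "e \<in> ?D" using e X by auto
      ultimately have "F \<in> ?B" using key X XF by auto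
      then show "X \<in> (\<lambda>(e, F). insert e F) ` (?D \<times> ?B)"
        using XF \<open>e \<in> ?D\<close> by (auto intro!: image_eqI[of _ _ "(e, F)"])
    qed
  qed
  from bij_betw_same_card[OF this] show ?thesis
    by (simp add: card_cartesian_product)
qed

lemma total_leaves_eq:
  assumes "simple_graph G"
  shows "total_leaves G = (\<Sum>v\<in>verts G. vert_degree G v *
    card {F. F \<subseteq> {e \<in> edges G. v \<notin> e} \<and> tree_on (verts G - {v}) F})"
proof (cases "verts G = {}")
  case True
  then show ?thesis by (simp add: total_leaves_def leaves_def spanning_trees_def)
next
  case False
  have finV: "finite (verts G)" and E: "\<And>e. e \<in> edges G \<Longrightarrow> e \<subseteq> verts G \<and> card e = 2"
    using assms by (auto simp: simple_graph_def)
  have "edges G \<subseteq> Pow (verts G)" using E by auto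
  then have finE: "finite (edges G)" using finV by (meson finite_Pow_iff finite_subset)
  define A where "A = {F. F \<subseteq> edges G \<and> tree_on (verts G) F}"
  have finA: "finite A" using finE by (auto simp: A_def)
  have "total_leaves G = (\<Sum>F\<in>A. card {v \<in> verts G. card {e \<in> F. v \<in> e} = 1})"
    unfolding total_leaves_def spanning_trees_eq[OF assms False] A_def
    by (subst sum.reindex) (auto simp: inj_on_def leaves_def vert_degree_def)
  also have "\<dots> = (\<Sum>F\<in>A. \<Sum>v\<in>verts G. if card {e \<in> F. v \<in> e} = 1 then 1 else 0)"
    using finV by (intro sum.cong refl) (simp add: sum.If_cases Int_def)
  also have "\<dots> = (\<Sum>v\<in>verts G. \<Sum>F\<in>A. if card {e \<in> F. v \<in> e} = 1 then 1 else 0)"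
    by (rule sum.swap)
  also have "\<dots> = (\<Sum>v\<in>verts G. card {F. F \<subseteq> edges G \<and> tree_on (verts G) F \<and> card {e \<in> F. v \<in> e}
      = 1})"
    using finA by (intro sum.cong refl) (simp add: sum.If_cases Int_def A_def conj_ac)
  also have "\<dots> = (\<Sum>v\<in>verts G. vert_degree G v *
    card {F. F \<subseteq> {e \<in> edges G. v \<notin> e} \<and> tree_on (verts G - {v}) F})"
    unfolding vert_degree_def
    using card_pendant_trees[OF finE E] by (intro sum.cong refl) auto
  finally show ?thesis .
qed

lemma walk_path_graph_dist:
  assumes "successively (\<lambda>a b. {a, b} \<in> edges (path_graph n)) p" "p \<noteq> []"
  shows "\<bar>int (last p) - int (hd p)\<bar> \<le> int (length p - 1)"
  using assms
proof (induction p rule: induct_list012)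
  case (3 x y zs)
  then have "\<bar>int y - int x\<bar> = 1" by (auto simp: path_graph_def doubleton_eq_iff)
  with 3 show ?case by auto
qed auto

lemma walk_path_graph_upt:
  assumes "1 \<le> u" "u \<le> v" "v \<le> n"
  shows "walk_betw (path_graph n) u [u..<Suc v] v"
  using assms by (auto simp: walk_betw_def walk_def path_graph_def hd_upt simp del: upt_Suc)

lemma walk_betw_rev: "walk_betw G u p v \<Longrightarrow> walk_betw G v (rev p) u"
  by (auto simp: walk_betw_def walk_iff hd_rev last_rev insert_commute)

text \<open>
  One edge of the path changes the position by one, which bounds the length of every walk from
  below; the interval between the two vertices is a walk of exactly this length.
\<close>

lemma graph_dist_path_le_iff:
  assumes "u \<in> {1..n}" "v \<in> {1..n}"
  shows "graph_dist (path_graph n) u v \<le> enat k \<longleftrightarrow> \<bar>int v - int u\<bar> \<le> int k"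
proof
  assume le: "graph_dist (path_graph n) u v \<le> enat k"
  show "\<bar>int v - int u\<bar> \<le> int k"
  proof (rule ccontr)
    assume far: "\<not> \<bar>int v - int u\<bar> \<le> int k"
    have "enat (Suc k) \<le> graph_dist (path_graph n) u v"
      unfolding graph_dist_def
    proof (intro INF_greatest)
      fix p assume "p \<in> {p. walk_betw (path_graph n) u p v}"
      then have "\<bar>int v - int u\<bar> \<le> int (length p - 1)"
        using walk_path_graph_dist[of n p] by (auto simp: walk_betw_def walk_iff)
      then show "enat (Suc k) \<le> enat (length p - 1)" using far by simp
    qed
    from this le have "enat (Suc k) \<le> enat k" by (rule order_trans)
    then show False by simp
  qed
next
  assume near: "\<bar>int v - int u\<bar> \<le> int k"
  have "\<exists>p. walk_betw (path_graph n) u p v \<and> length p - 1 \<le> k"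
  proof (cases "u \<le> v")
    case True
    then show ?thesis using walk_path_graph_upt[of u v n] assms near
      by (intro exI[of _ "[u..<Suc v]"]) auto
  next
    case False
    then show ?thesis using walk_betw_rev[OF walk_path_graph_upt[of v u n]] assms near
      by (intro exI[of _ "rev [v..<Suc u]"]) auto
  qed
  then show "graph_dist (path_graph n) u v \<le> enat k"
    unfolding graph_dist_def by (meson INF_lower2 enat_ord_simps(1) mem_Collect_eq)
qed

lemma edges_power_path:
  "edges (graph_power (path_graph n) k) = {{a, b} |a b. 1 \<le> a \<and> a < b \<and> b \<le> a + k \<and> b \<le> n}"
    (is "?L = ?R")
proof -
  have one_le: "1 \<le> x \<longleftrightarrow> x \<noteq> 0" for x :: enat
    by (cases x) (auto simp: one_enat_def zero_enat_def)
  have "graph_dist (path_graph n) u v = 0 \<longleftrightarrow> u = v" if "u \<in> {1..n}" "v \<in> {1..n}" for u v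
    using graph_dist_path_le_iff[OF that, of 0] by (auto simp flip: zero_enat_def)
  then have dist1: "1 \<le> graph_dist (path_graph n) u v \<longleftrightarrow> u \<noteq> v" if "u \<in> {1..n}" "v \<in> {1..n}" for u v
    using that one_le by simp
  have L: "?L = {{u, v} |u v. u \<in> {1..n} \<and> v \<in> {1..n} \<and> u \<noteq> v \<and> \<bar>int v - int u\<bar> \<le> int k}"
  proof -
    have "u \<in> {1..n} \<and> v \<in> {1..n} \<and> 1 \<le> graph_dist (path_graph n) u v \<and>
        graph_dist (path_graph n) u v \<le> enat k \<longleftrightarrow>
      u \<in> {1..n} \<and> v \<in> {1..n} \<and> u \<noteq> v \<and> \<bar>int v - int u\<bar> \<le> int k" for u v
      using dist1 graph_dist_path_le_iff by blast
    then show ?thesis by (simp add: graph_power_def path_graph_def)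
  qed
  show ?thesis
  proof (intro equalityI subsetI)
    fix e assume "e \<in> ?L"
    then obtain u v where e: "e = {u, v}" "u \<in> {1..n}" "v \<in> {1..n}" "u \<noteq> v"
        "\<bar>int v - int u\<bar> \<le> int k"
      unfolding L by blast
    show "e \<in> ?R"
    proof (cases "u < v")
      case True
      then show ?thesis using e by (intro CollectI exI[of _ u] exI[of _ v]) auto
    next
      case False
      then show ?thesis using e by (intro CollectI exI[of _ v] exI[of _ u]) auto
    qed
  next
    fix e assume "e \<in> ?R"
    then obtain a b where "e = {a, b}" "1 \<le> a" "a < b" "b \<le> a + k" "b \<le> n" by blast
    then show "e \<in> ?L" unfolding L by (intro CollectI exI[of _ a] exI[of _ b]) auto
  qed
qed

lemma verts_power_path: "verts (graph_power (path_graph n) k) = {1..n}"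
  by (simp add: graph_power_def path_graph_def)

lemma vert_degree_power_path:
  assumes "v \<in> {1..n}"
  shows "vert_degree (graph_power (path_graph n) k) v = min k (v - 1) + min k (n - v)"
proof -
  let ?D = "{e \<in> edges (graph_power (path_graph n) k). v \<in> e}"
  have "?D = (\<lambda>u. {v, u}) ` ({max 1 (v - k)..<v} \<union> {v<..min n (v + k)})"
  proof (intro equalityI subsetI)
    fix e assume "e \<in> ?D"
    then obtain a b where ab: "e = {a, b}" "1 \<le> a" "a < b" "b \<le> a + k" "b \<le> n" and "v \<in> e"
      unfolding edges_power_path by blast
    from \<open>v \<in> e\<close> have "v = a \<or> v = b" unfolding ab(1) by simp
    then show "e \<in> (\<lambda>u. {v, u}) ` ({max 1 (v - k)..<v} \<union> {v<..min n (v + k)})"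
      unfolding ab(1)
      using ab(2-5) by (elim disjE) (auto simp: insert_commute)
  next
    fix e assume "e \<in> (\<lambda>u. {v, u}) ` ({max 1 (v - k)..<v} \<union> {v<..min n (v + k)})"
    then obtain u where u: "e = {v, u}" "u \<in> {max 1 (v - k)..<v} \<union> {v<..min n (v + k)}" by auto
    have "\<exists>a b. e = {a, b} \<and> 1 \<le> a \<and> a < b \<and> b \<le> a + k \<and> b \<le> n"
    proof (cases "u < v")
      case True
      then show ?thesis using u assms by (intro exI[of _ u] exI[of _ v]) auto
    next
      case False
      then show ?thesis using u assms by (intro exI[of _ v] exI[of _ u]) auto
    qed
    then show "e \<in> ?D" using u(1) unfolding edges_power_path by simp
  qed
  moreover have "inj (\<lambda>u. {v, u})" by (auto simp: inj_on_def doubleton_eq_iff)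
  ultimately have "card ?D = card ({max 1 (v - k)..<v} \<union> {v<..min n (v + k)})"
    by (simp add: card_image inj_on_subset)
  also have "\<dots> = card {max 1 (v - k)..<v} + card {v<..min n (v + k)}"
    by (rule card_Un_disjoint) auto
  also have "\<dots> = min k (v - 1) + min k (n - v)" using assms by auto
  finally show ?thesis by (simp add: vert_degree_def)
qed

section \<open>Counting completions of a forest through its frontier\<close>

text \<open>
  A graph is presented by a program that reveals it one piece at a time, while a list of the
  vertices that may still receive edges, the newest first, is kept as the frontier.  \<open>Vert\<close> puts
  a new vertex in front, \<open>Edge i\<close> offers the edge between entries 0 and \<open>i\<close>, and \<open>Drop\<close> retires
  the oldest entry.  \<open>Skip\<close> passes over a vertex name, so that the other vertices of a graph
  keep their names when one of them is missing.
\<close>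

datatype instr = Vert | Skip | Edge nat | Drop

text \<open>
  The possible effects of one instruction on the partition of the frontier into components.  A
  partition is coded by labels, numbered in the order of their first occurrence, so that the
  newest vertex has label 0 and equal partitions have equal codes.  An offered edge may always
  be left out; it may be taken when its ends have different labels, and then the label of the
  older end disappears and the larger ones move down.  An entry can only be retired when its
  component keeps another entry, since otherwise it would stay cut off for ever.
\<close>

fun moves :: "instr \<Rightarrow> nat list \<Rightarrow> nat list list" where
  "moves Vert c = [0 # map Suc c]"
| "moves Skip c = [c]"
| "moves (Edge i) c = c # (if c ! i = 0 then []
     else [map (\<lambda>z. if z = c ! i then 0 else if c ! i < z then z - 1 else z) c])"
| "moves Drop c = (if last c \<in> set (butlast c) then [butlast c] else [])"

fun completions :: "instr list \<Rightarrow> nat list \<Rightarrow> int" where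
  "completions [] c = (if \<forall>x\<in>set c. x = hd c then 1 else 0)"
| "completions (x # os) c = sum_list (map (completions os) (moves x c))"

fun future_edges :: "instr list \<Rightarrow> nat list \<Rightarrow> nat \<Rightarrow> nat set set" where
  "future_edges [] W j = {}"
| "future_edges (Vert # os) W j = future_edges os (j # W) (Suc j)"
| "future_edges (Skip # os) W j = future_edges os W (Suc j)"
| "future_edges (Edge i # os) W j = insert {W ! 0, W ! i} (future_edges os W j)"
| "future_edges (Drop # os) W j = future_edges os (butlast W) j"

fun future_verts :: "instr list \<Rightarrow> nat \<Rightarrow> nat set" where
  "future_verts [] j = {}"
| "future_verts (Vert # os) j = insert j (future_verts os (Suc j))"
| "future_verts (Skip # os) j = future_verts os (Suc j)"
| "future_verts (Edge i # os) j = future_verts os j"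
| "future_verts (Drop # os) j = future_verts os j"

text \<open>
  No edge is offered twice, and the last entry of the frontier is never retired.
\<close>

fun well_formed :: "instr list \<Rightarrow> nat list \<Rightarrow> nat \<Rightarrow> bool" where
  "well_formed [] W j \<longleftrightarrow> True"
| "well_formed (Vert # os) W j \<longleftrightarrow> well_formed os (j # W) (Suc j)"
| "well_formed (Skip # os) W j \<longleftrightarrow> well_formed os W (Suc j)"
| "well_formed (Edge i # os) W j \<longleftrightarrow> 0 < i \<and> i < length W \<and> {W ! 0, W ! i} \<notin> future_edges os W j
    \<and> well_formed os W j"
| "well_formed (Drop # os) W j \<longleftrightarrow> 2 \<le> length W \<and> well_formed os (butlast W) j"

lemma finite_future_edges: "finite (future_edges os W j)"
  by (induction os W j rule: future_edges.induct) auto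

lemma future_edges_subset: "well_formed os W j \<Longrightarrow> e \<in> future_edges os W j \<Longrightarrow> e \<subseteq> set W \<union> {j..}"
proof (induction os W j rule: future_edges.induct)
  case (2 os W j)
  then show ?case by fastforce
next
  case (3 os W j)
  then show ?case by fastforce
next
  case (4 i os W j)
  then have "0 < length W" by auto
  then show ?case using 4 nth_mem[of 0 W] nth_mem[of i W] by auto
next
  case (5 os W j)
  then show ?case using in_set_butlastD by fastforce
qed auto

lemma card_Pow_insert_split:
  assumes "finite X" "e \<notin> X"
  shows "card {S. S \<subseteq> insert e X \<and> P S} = card {S. S \<subseteq> X \<and> P S} + card {S. S \<subseteq> X \<and> P (insert e S)}"
proof -
  have "{S. S \<subseteq> insert e X \<and> P S} = {S. S \<subseteq> X \<and> P S} \<union> insert e ` {S. S \<subseteq> X \<and> P (insert e S)}"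
    (is "?L = ?A \<union> insert e ` ?B")
  proof (intro equalityI subsetI)
    fix S assume S: "S \<in> ?L"
    show "S \<in> ?A \<union> insert e ` ?B"
    proof (cases "e \<in> S")
      case True
      then have "S = insert e (S - {e})" by auto
      moreover have "S - {e} \<in> ?B" using S True by (auto simp: insert_absorb)
      ultimately show ?thesis by blast
    qed (use S in auto)
  qed auto
  moreover have "?A \<inter> insert e ` ?B = {}" using assms(2) by auto
  moreover have "inj_on (insert e) ?B" using assms(2) by (auto simp: inj_on_def)
  moreover have "finite ?A" "finite (insert e ` ?B)" using assms(1) by auto
  ultimately show ?thesis by (simp add: card_Un_disjoint card_image)
qed

text \<open>
  The label list \<open>c\<close> describes the forest \<open>F\<close> on \<open>V\<close> as seen from its frontier \<open>W\<close>: every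
  component of \<open>F\<close> meets \<open>W\<close>, and equal labels mean the same component.
\<close>

definition frontier :: "nat set \<Rightarrow> nat set set \<Rightarrow> nat list \<Rightarrow> nat list \<Rightarrow> bool" where
  "frontier V F W c \<longleftrightarrow> distinct W \<and> set W \<subseteq> V \<and> length c = length W \<and>
     (\<forall>v\<in>V. \<exists>w\<in>set W. (v, w) \<in> conn F) \<and>
     (\<forall>i<length W. \<forall>j<length W. c ! i = c ! j \<longleftrightarrow> (W ! i, W ! j) \<in> conn F) \<and>
     (c \<noteq> [] \<longrightarrow> c ! 0 = 0)"

lemma frontier_Vert:
  assumes fr: "frontier V F W c" and V: "V \<subseteq> {..<j}" and F: "\<And>e. e \<in> F \<Longrightarrow> e \<subseteq> V"
  shows "frontier (insert j V) F (j # W) (0 # map Suc c)"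
proof -
  have j: "j \<notin> V" using V by auto
  have jj: "(j, w) \<in> conn F \<longleftrightarrow> w = j" "(w, j) \<in> conn F \<longleftrightarrow> w = j" for w
    using conn_outside[of j w F] F j conn_commute[of j w F] by auto
  have "(0 # map Suc c) ! a = (0 # map Suc c) ! b \<longleftrightarrow> ((j # W) ! a, (j # W) ! b) \<in> conn F"
    if "a < length (j # W)" "b < length (j # W)" for a b
  proof -
    have "W ! i \<noteq> j" if "i < length W" for i
      using fr j nth_mem[OF that] by (auto simp: frontier_def)
    then show ?thesis
      using fr that jj by (cases a; cases b) (auto simp: frontier_def)
  qed
  then show ?thesis using fr j unfolding frontier_def by auto
qed

lemma frontier_Edge:
  assumes fr: "frontier V F W c" and i: "i < length W" and ne: "c ! i \<noteq> 0"
  shows "frontier V (insert {W ! 0, W ! i} F) W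
    (map (\<lambda>z. if z = c ! i then 0 else if c ! i < z then z - 1 else z) c)"
    (is "frontier V ?F W (map ?f c)")
proof -
  have len: "length c = length W" "0 < length W" and c0: "c ! 0 = 0"
    using fr i by (auto simp: frontier_def)
  have pat: "c ! a = c ! b \<longleftrightarrow> (W ! a, W ! b) \<in> conn F" if "a < length W" "b < length W" for a b
    using fr that by (auto simp: frontier_def)
  have f: "?f x = ?f y \<longleftrightarrow> x = y \<or> x = 0 \<and> y = c ! i \<or> x = c ! i \<and> y = 0" for x y
    using ne by auto
  have "map ?f c ! a = map ?f c ! b \<longleftrightarrow> (W ! a, W ! b) \<in> conn ?F"
    if ab: "a < length W" "b < length W" for a b
  proof -
    have "map ?f c ! a = map ?f c ! b \<longleftrightarrow> ?f (c ! a) = ?f (c ! b)" using ab len by simp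
    also have "\<dots> \<longleftrightarrow> c ! a = c ! b \<or> c ! a = c ! 0 \<and> c ! i = c ! b \<or> c ! a = c ! i \<and> c ! 0 = c ! b"
      unfolding f c0 by auto
    also have "\<dots> \<longleftrightarrow> (W ! a, W ! b) \<in> conn ?F"
      unfolding conn_insert using pat ab len(2) i by simp
    finally show ?thesis .
  qed
  moreover have "map ?f c ! 0 = 0" using len c0 by simp
  moreover have "\<forall>v\<in>V. \<exists>w\<in>set W. (v, w) \<in> conn ?F"
    using fr conn_mono[of F ?F] unfolding frontier_def by blast
  ultimately show ?thesis using fr by (simp add: frontier_def del: nth_map)
qed

lemma nth_eq_last_butlast:
  assumes "length c = length W" "2 \<le> length W"
  shows "last c \<in> set (butlast c) \<longleftrightarrow> (\<exists>i<length W - 1. c ! i = c ! (length W - 1))"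
proof -
  have "c \<noteq> []" using assms by auto
  then show ?thesis using assms by (auto simp: in_set_conv_nth last_conv_nth nth_butlast)
qed

lemma frontier_Drop:
  assumes fr: "frontier V F W c" and two: "2 \<le> length W" and last: "last c \<in> set (butlast c)"
  shows "frontier V F (butlast W) (butlast c)"
proof -
  let ?m = "length W - 1"
  have len: "length c = length W" using fr by (simp add: frontier_def)
  obtain i where i: "i < ?m" "c ! i = c ! ?m"
    using last nth_eq_last_butlast[OF len two] by auto
  have m: "?m < length W" using two by simp
  have "i < length W" using i by simp
  then have im: "(W ! ?m, W ! i) \<in> conn F" using fr i m unfolding frontier_def by metis
  have "\<exists>w\<in>set (butlast W). (v, w) \<in> conn F" if v: "v \<in> V" for v
  proof -
    obtain w where w: "w \<in> set W" "(v, w) \<in> conn F" using fr v by (auto simp: frontier_def)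
    have Wi: "W ! i \<in> set (butlast W)" using i(1) by (auto simp: in_set_conv_nth nth_butlast)
    show ?thesis
    proof (cases "w \<in> set (butlast W)")
      case False
      have "W \<noteq> []" using two by auto
      then have "set W = insert (W ! ?m) (set (butlast W))"
        by (metis append_butlast_last_id last_conv_nth list.simps(15) rotate1.simps(2) set_rotate1)
      then have "w = W ! ?m" using False w(1) by auto
      then have "(v, W ! i) \<in> conn F" using w im conn_trans by metis
      then show ?thesis using Wi by blast
    qed (use w in blast)
  qed
  moreover have "butlast c ! 0 = 0"
  proof -
    have "c \<noteq> []" "0 < length (butlast c)" using two len by auto
    then show ?thesis using fr by (auto simp: frontier_def nth_butlast)
  qed
  ultimately show ?thesis
    using fr by (auto simp: frontier_def nth_butlast distinct_butlast dest: in_set_butlastD)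
qed

text \<open>
  If the oldest entry shares its component with no other frontier vertex, that component can
  receive no future edge: it stays a component and the graph never becomes connected.
\<close>

lemma stuck_Drop:
  assumes fr: "frontier V F W c" and two: "2 \<le> length W" and last: "last c \<notin> set (butlast c)"
    and well_formed: "well_formed os (butlast W) j" and V: "V \<subseteq> {..<j}" and F: "\<And>e. e \<in> F \<Longrightarrow> e \<subseteq> V"
    and S: "S \<subseteq> future_edges os (butlast W) j"
  shows "(last W, W ! 0) \<notin> conn (F \<union> S)"
proof
  let ?m = "length W - 1"
  let ?C = "{x. (last W, x) \<in> conn F}"
  have ne: "W \<noteq> []" using two by auto
  then have lst: "last W = W ! ?m" by (simp add: last_conv_nth)
  have len: "length c = length W" using fr by (simp add: frontier_def)
  have new: "(last W, w) \<notin> conn F" if "w \<in> set (butlast W)" for w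
  proof -
    obtain i where i: "i < ?m" "w = W ! i"
      using \<open>w \<in> _\<close> by (auto simp: in_set_conv_nth nth_butlast)
    have "c ! i \<noteq> c ! ?m" using last nth_eq_last_butlast[OF len two] i by auto
    moreover have "i < length W" "?m < length W" using i by auto
    ultimately show ?thesis using fr i lst unfolding frontier_def by metis
  qed
  have "last W \<in> V" using fr ne by (auto simp: frontier_def)
  assume "(last W, W ! 0) \<in> conn (F \<union> S)"
  then have "W ! 0 \<in> ?C"
  proof (rule conn_isolated)
    fix a b assume "{a, b} \<in> F \<union> S" and a: "a \<in> ?C"
    from this(1) show "b \<in> ?C"
    proof
      assume "{a, b} \<in> F"
      then show ?thesis using a conn_trans conn_edge by fastforce
    next
      assume "{a, b} \<in> S"
      then have "a \<in> set (butlast W) \<union> {j..}" using S future_edges_subset[OF well_formed] by blast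
      moreover have "a \<notin> V" if "a \<ge> j" using that V by auto
      moreover have "a \<in> V"
      proof (rule ccontr)
        assume "a \<notin> V"
        then have "last W = a" using conn_outside[of a "last W" F] conn_sym[of
            "last W" a F] F a by auto
        then show False using \<open>last W \<in> V\<close> \<open>a \<notin> V\<close> by simp
      qed
      ultimately show ?thesis using new a by auto
    qed
  qed simp
  then have "(last W, W ! 0) \<in> conn F" by simp
  moreover have "W ! 0 \<in> set (butlast W)" using two by
      (auto simp: in_set_conv_nth nth_butlast intro!: exI[of _ 0])
  ultimately show False using new by blast
qed

text \<open>
  The number of ways to complete a forest by future edges depends only on the partition of the
  frontier.  Each instruction splits the set of completions in the same way as \<open>moves\<close> splits
  the labels: by whether the offered edge is taken, or, for \<open>Drop\<close>, by whether a completion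
  is still possible.
\<close>

theorem card_completions:
  assumes "well_formed os W j" "frontier V F W c" "V \<subseteq> {..<j}" "\<And>e. e \<in> F \<Longrightarrow> e \<subseteq> V"
    "forest F" "F \<inter> future_edges os W j = {}"
  shows "int (card {S. S \<subseteq> future_edges os W j \<and> tree_on (V \<union> future_verts os j) (F \<union> S)})
      = completions os c"
  using assms
proof (induction os W j arbitrary: V F c rule: future_edges.induct)
  case (1 W j)
  have "V \<times> V \<subseteq> conn F \<longleftrightarrow> (\<forall>x\<in>set c. x = hd c)"
  proof (cases "W = []")
    case True
    then show ?thesis using 1 by (auto simp: frontier_def)
  next
    case False
    have len: "length c = length W" and pat: "\<And>a b. a < length W \<Longrightarrow> b < length W \<Longrightarrow> c ! a = c ! b
        \<longleftrightarrow> (W ! a, W ! b) \<in> conn F"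
      and V: "\<And>v. v \<in> V \<Longrightarrow> \<exists>w\<in>set W. (v, w) \<in> conn F" and WV: "set W \<subseteq> V"
      using 1 by (auto simp: frontier_def)
    have hd: "hd c = c ! 0" using False len by (cases c) auto
    have "(\<forall>x\<in>set c. x = hd c) \<longleftrightarrow> (\<forall>w\<in>set W. (w, W ! 0) \<in> conn F)"
      unfolding hd using pat len False by (auto simp: all_set_conv_all_nth)
    also have "\<dots> \<longleftrightarrow> V \<times> V \<subseteq> conn F"
    proof
      assume *: "\<forall>w\<in>set W. (w, W ! 0) \<in> conn F"
      have that: "(v, W ! 0) \<in> conn F" if "v \<in> V" for v
        using V[OF that] * conn_trans by meson
      then show "V \<times> V \<subseteq> conn F" 
      proof (intro subrelI)
        fix a b assume "(a, b) \<in> V \<times> V"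
        with that have "(a, W ! 0) \<in> conn F" "(b, W ! 0) \<in> conn F" by auto
        then show "(a, b) \<in> conn F" by (metis conn_trans conn_sym)
      qed
    next
      assume "V \<times> V \<subseteq> conn F"
      moreover have "W ! 0 \<in> V" using WV False by auto
      ultimately show "\<forall>w\<in>set W. (w, W ! 0) \<in> conn F" using WV by auto
    qed
    finally show ?thesis by simp
  qed
  moreover have "{S. S \<subseteq> future_edges [] W j \<and> tree_on (V \<union> future_verts [] j) (F \<union> S)} =
      (if V \<times> V \<subseteq> conn F then {{}} else {})"
    using 1 by (auto simp: tree_on_def)
  ultimately show ?case by simp
next
  case (2 os W j)
  have "int (card {S. S \<subseteq> future_edges os (j # W) (Suc j)
      \<and> tree_on (insert j V \<union> future_verts os (Suc j)) (F \<union> S)})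
      = completions os (0 # map Suc c)"
  proof (rule "2.IH")
    show "frontier (insert j V) F (j # W) (0 # map Suc c)"
      using "2.prems" by (intro frontier_Vert) auto
  qed (use "2.prems" in auto)
  then show ?case by simp
next
  case (3 os W j)
  have "int (card {S. S \<subseteq> future_edges os W (Suc j)
      \<and> tree_on (V \<union> future_verts os (Suc j)) (F \<union> S)})
      = completions os c"
    by (rule "3.IH") (use "3.prems" in auto)
  then show ?case by simp
next
  case (4 i os W j)
  let ?e = "{W ! 0, W ! i}"
  let ?X = "future_edges os W j" and ?P = "\<lambda>S. tree_on (V \<union> future_verts os j) (F \<union> S)"
  have e: "0 < i" "i < length W" "?e \<notin> ?X" "?e \<notin> F" and well_formed: "well_formed os W j" using
      "4.prems" by auto
  have WV: "set W \<subseteq> V" using "4.prems" by (simp add: frontier_def)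
  have "0 < length W" using e(2) by auto
  then have eV: "?e \<subseteq> V" using WV e(2) nth_mem[of i W] nth_mem[of 0 W] by auto
  have split: "card {S. S \<subseteq> insert ?e ?X \<and> ?P S} =
      card {S. S \<subseteq> ?X \<and> ?P S} + card {S. S \<subseteq> ?X \<and> ?P (insert ?e S)}"
    using finite_future_edges e(3) by (rule card_Pow_insert_split)
  have without: "int (card {S. S \<subseteq> ?X \<and> ?P S}) = completions os c"
    by (rule "4.IH") (use "4.prems" well_formed in auto)
  have c: "c ! i = 0 \<longleftrightarrow> (W ! 0, W ! i) \<in> conn F"
  proof -
    have "0 < length W" "c \<noteq> []" using e "4.prems"(2) by (auto simp: frontier_def)
    then have "c ! 0 = 0" "c ! 0 = c ! i \<longleftrightarrow> (W ! 0, W ! i) \<in> conn F"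
      using "4.prems"(2) e(2) unfolding frontier_def by blast+
    then show ?thesis by auto
  qed
  show ?case
  proof (cases "c ! i = 0")
    case True
    have "\<not> ?P (insert ?e S)" for S
    proof
      assume "?P (insert ?e S)"
      then have "forest (insert ?e F)"
        unfolding tree_on_def by (elim conjE) (erule forest_mono, auto)
      then show False using forest_insert[OF e(4)] True c by simp
    qed
    then show ?thesis using split without True by simp
  next
    case False
    have "int (card {S. S \<subseteq> ?X \<and> tree_on (V \<union> future_verts os j) (insert ?e F \<union> S)}) =
      completions os (map (\<lambda>z. if z = c ! i then 0 else if c ! i < z then z - 1 else z) c)"
    proof (rule "4.IH")
      show "forest (insert ?e F)" using forest_insert[OF e(4)] False c "4.prems"(5) by simp
      show "frontier V (insert ?e F) W (map (\<lambda>z. if z = c ! i then 0 else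
          if c ! i < z then z - 1 else z) c)"
        using "4.prems"(2) e(2) False by (rule frontier_Edge)
      fix x assume "x \<in> insert ?e F"
      then show "x \<subseteq> V" using eV "4.prems"(4) by blast
    qed (use "4.prems" well_formed e(3) in auto)
    then show ?thesis using split without False by simp
  qed
next
  case (5 os W j)
  have two: "2 \<le> length W" and well_formed: "well_formed os (butlast W) j" using "5.prems" by auto
  show ?case
  proof (cases "last c \<in> set (butlast c)")
    case True
    have "int (card {S. S \<subseteq> future_edges os (butlast W) j
        \<and> tree_on (V \<union> future_verts os j) (F \<union> S)})
      = completions os (butlast c)"
      by (rule "5.IH") (use "5.prems" well_formed frontier_Drop[OF "5.prems"(2) two True] in auto)
    then show ?thesis using True by simp
  next
    case False
    have "\<not> tree_on (V \<union> future_verts os j) (F \<union> S)" if "S \<subseteq> future_edges os (butlast W) j" for S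
    proof
      assume "tree_on (V \<union> future_verts os j) (F \<union> S)"
      moreover have "W \<noteq> []" using two by auto
      then have "last W \<in> V" "W ! 0 \<in> V"
        using "5.prems"(2) unfolding frontier_def by (auto simp: subset_iff)
      ultimately have "(last W, W ! 0) \<in> conn (F \<union> S)" by (auto simp: tree_on_def)
      then show False using stuck_Drop[OF "5.prems"(2) two False well_formed
          "5.prems"(3,4) that] by simp
    qed
    then have none: "{S. S \<subseteq> future_edges os (butlast W) j
        \<and> tree_on (V \<union> future_verts os j) (F \<union> S)} = {}"
      by blast
    have "completions (Drop # os) c = 0" using False by simp
    then show ?thesis by (simp only: future_edges.simps future_verts.simps none card.empty of_nat_0)
  qed
qed

section \<open>Building the fourth power of a path without one vertex\<close>

text \<open>
  The earlier neighbours of vertex \<open>j\<close> in the fourth power of the path without vertex \<open>v\<close>, the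
  newest first.
\<close>

definition window :: "nat \<Rightarrow> nat \<Rightarrow> nat list" where
  "window v j = rev (filter (\<lambda>i. i \<noteq> v \<and> 1 \<le> i) [j - 4..<j])"

text \<open>
  After vertex \<open>j\<close> has received its edges, vertex \<open>j - 4\<close> is out of reach of all later ones.  It
  is not dropped when it is the deleted vertex \<open>v\<close>, which was never in the frontier.
\<close>

definition stage :: "nat \<Rightarrow> nat \<Rightarrow> instr list" where
  "stage v j = (if j = v then [Skip] else Vert # map Edge [1..<Suc (length (window v j))])
     @ (if 5 \<le> j \<and> j - 4 \<noteq> v then [Drop] else [])"

definition program :: "nat \<Rightarrow> nat \<Rightarrow> nat \<Rightarrow> instr list" where
  "program v j n = concat (map (stage v) [j..<Suc n])"

lemma window_extend:
  "(if j = v then window v j else j # window v j) = rev (filter (\<lambda>i. i \<noteq> v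
      \<and> 1 \<le> i) [j - 4..<Suc j])"
  if "1 \<le> j"
  using that by (auto simp: window_def)

lemma window_Suc:
  assumes "1 \<le> j" and W_def: "W = (if j = v then window v j else j # window v j)"
  shows "window v (Suc j) = (if 5 \<le> j \<and> j - 4 \<noteq> v then butlast W else W)"
proof (cases "4 \<le> j")
  case True
  then have "[j - 4..<Suc j] = (j - 4) # [Suc j - 4..<Suc j]"
    using upt_conv_Cons[of "j - 4" "Suc j", OF le_imp_less_Suc[OF diff_le_self]]
    by (simp only: Suc_diff_le)
  then have "W = window v (Suc j) @ (if j - 4 \<noteq> v \<and> 1 \<le> j - 4 then [j - 4] else [])"
    unfolding W_def window_extend[OF assms(1)] by (auto simp: window_def)
  then show ?thesis using True by auto
next
  case False
  then have "j - 4 = 0" "Suc j - 4 = 0" by auto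
  then show ?thesis using False unfolding W_def window_extend[OF assms(1)] by
      (auto simp: window_def)
qed

lemma set_window: "set (window v j) = {i. 1 \<le> i \<and> j \<le> i + 4 \<and> i < j \<and> i \<noteq> v}"
  by (auto simp: window_def)

lemma distinct_window: "distinct (window v j)"
  by (simp add: window_def)

lemma length_window: "length (window v j) = (if j \<le> 4 then j - 1 else 4) - (if v < j \<and> j \<le> v + 4
    \<and> 1 \<le> v then 1 else 0)"
proof -
  have "length (window v j) = card (set (window v j))" by (simp add: distinct_card distinct_window)
  also have "set (window v j) = {max 1 (j - 4)..<j} - (if v < j \<and> j \<le> v + 4
      \<and> 1 \<le> v then {v} else {})"
    by (auto simp: set_window)
  also have "card \<dots> = (if j \<le> 4 then j - 1 else 4) - (if v < j \<and> j \<le> v + 4 \<and> 1 \<le> v then 1 else 0)"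
    by (auto simp: card_Diff_singleton_if)
  finally show ?thesis .
qed

lemma future_edges_Edges:
  "future_edges (map Edge is @ os) W j = {{W ! 0, W ! i} |i. i \<in> set is} \<union> future_edges os W j"
  by (induction "is") auto

lemma future_verts_Edges: "future_verts (map Edge is @ os) j = future_verts os j"
  by (induction "is") auto

lemma well_formed_Edges:
  assumes "distinct W" "well_formed os W j" "distinct is" "\<And>i. i \<in> set is \<Longrightarrow> 0 < i \<and> i < length W"
    "\<And>i. i \<in> set is \<Longrightarrow> {W ! 0, W ! i} \<notin> future_edges os W j"
  shows "well_formed (map Edge is @ os) W j"
  using assms(3-)
proof (induction "is")
  case (Cons i "is")
  have "{W ! 0, W ! i} \<notin> {{W ! 0, W ! i} |i. i \<in> set is}"
  proof
    assume "{W ! 0, W ! i} \<in> {{W ! 0, W ! i} |i. i \<in> set is}"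
    then obtain k where k: "k \<in> set is" "{W ! 0, W ! i} = {W ! 0, W ! k}" by blast
    have "W ! i \<noteq> W ! k"
      using k(1) Cons.prems(1,2) assms(1) by (auto simp: nth_eq_iff_index_eq)
    moreover have "W ! 0 \<noteq> W ! i"
      using Cons.prems(2)[of i] assms(1) by (subst nth_eq_iff_index_eq) auto
    ultimately show False using k(2) by (auto simp: doubleton_eq_iff)
  qed
  then show ?case using Cons assms(2) by (auto simp: future_edges_Edges)
qed (simp add: assms(2))

text \<open>
  By induction from the last vertex down: stage \<open>j\<close> offers exactly the edges whose larger end is
  \<open>j\<close>, and leaves the window of vertex \<open>j + 1\<close> as frontier.
\<close>

lemma program_correct:
  assumes "1 \<le> j" "j \<le> Suc n"
  shows "future_edges (program v j n) (window v j) j =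
      {{a, b} |a b. 1 \<le> a \<and> a < b \<and> b \<le> a + 4 \<and> j \<le> b \<and> b \<le> n \<and> a \<noteq> v \<and> b \<noteq> v} \<and>
    future_verts (program v j n) j = {j..n} - {v} \<and> well_formed (program v j n) (window v j) j"
  using assms(2,1)
proof (induction j rule: inc_induct)
  case base
  then show ?case by (auto simp: program_def)
next
  case (step j)
  define W where "W = (if j = v then window v j else j # window v j)"
  define rest where "rest = (if 5 \<le> j \<and> j - 4 \<noteq> v then [Drop] else []) @ program v (Suc j) n"
  let ?E = "\<lambda>j. {{a, b} |a b. 1 \<le> a \<and> a < b \<and> b \<le> a + 4 \<and> j \<le> b \<and> b \<le> n \<and> a \<noteq> v \<and> b \<noteq> v}"
  have j: "1 \<le> j" "j \<le> n" using step by auto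
  have IH: "future_edges (program v (Suc j) n) (window v (Suc j)) (Suc j) = ?E (Suc j)"
    "future_verts (program v (Suc j) n) (Suc j) = {Suc j..n} - {v}"
        "well_formed (program v (Suc j) n) (window v (Suc j)) (Suc j)"
    using step.IH by auto
  have program: "program v j n = (if j = v then [Skip] else Vert # map Edge [1..<length W]) @ rest"
    using j unfolding program_def rest_def
    by (subst upt_conv_Cons) (auto simp: stage_def W_def)
  have Wlen: "2 \<le> length W" if "5 \<le> j"
    using that by (auto simp: W_def length_window)
  have rest: "future_edges rest W (Suc j) = ?E (Suc j)" "future_verts rest (Suc j)
      = {Suc j..n} - {v}" "well_formed rest W (Suc j)"
    using IH window_Suc[OF j(1) W_def] Wlen unfolding rest_def by (auto split: if_splits)
  show ?case
  proof (cases "j = v")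
    case True
    have "?E (Suc j) = ?E j"
      by (intro Collect_cong ex_cong1) (use True in auto)
    then show ?thesis using True rest unfolding program by (auto simp: W_def)
  next
    case False
    have W: "W = j # window v j" using False by (simp add: W_def)
    have star: "{{W ! 0, W ! i} |i. i \<in> set [1..<length W]} = {{j, w} |w. w \<in> set (window v j)}"
    proof -
      have "{{W ! 0, W ! i} |i. i \<in> set [1..<length W]}
          = (\<lambda>w. {j, w}) ` (\<lambda>i. W ! i) ` {1..<length W}"
        unfolding set_upt W by (simp only: nth_Cons_0) blast
      also have "(\<lambda>i. W ! i) ` {1..<length W} = set (window v j)"
      proof -
        have "{1..<length W} = Suc ` {..<length (window v j)}"
          unfolding W by (auto simp: lessThan_atLeast0 image_Suc_atLeastLessThan)
        then show ?thesis unfolding W by (auto simp: image_image set_conv_nth)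
      qed
      finally show ?thesis by auto
    qed
    have E: "?E j = {{j, w} |w. w \<in> set (window v j)} \<union> ?E (Suc j)"
    proof (intro equalityI subsetI)
      fix e assume "e \<in> ?E j"
      then obtain a b where ab: "e = {a, b}" "1 \<le> a" "a < b" "b \<le> a + 4" "j \<le> b" "b \<le> n" "a \<noteq> v"
          "b \<noteq> v"
        by blast
      show "e \<in> {{j, w} |w. w \<in> set (window v j)} \<union> ?E (Suc j)"
      proof (cases "b = j")
        case True
        then have "e = {j, a} \<and> a \<in> set (window v j)" using ab by (auto simp: set_window)
        then show ?thesis by blast
      next
        case False
        then have "Suc j \<le> b" using ab by simp
        then show ?thesis using ab by blast
      qed
    next
      fix e assume "e \<in> {{j, w} |w. w \<in> set (window v j)} \<union> ?E (Suc j)"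
      then show "e \<in> ?E j"
      proof
        assume "e \<in> {{j, w} |w. w \<in> set (window v j)}"
        then obtain w where "e = {w, j}" "w \<in> set (window v j)" by blast
        then show ?thesis using j False
          by (intro CollectI exI[of _ w] exI[of _ j]) (auto simp: set_window)
      next
        assume "e \<in> ?E (Suc j)"
        then show ?thesis by (blast dest: Suc_leD)
      qed
    qed
    have new: "e \<notin> ?E (Suc j)" if "e \<in> {{j, w} |w. w \<in> set (window v j)}" for e
    proof
      assume "e \<in> ?E (Suc j)"
      then obtain a b where "e = {a, b}" "Suc j \<le> b" by blast
      with that show False by (auto simp: set_window doubleton_eq_iff)
    qed
    have "distinct W" using distinct_window W by (auto simp: set_window)
    then have "well_formed (map Edge [1..<length W] @ rest) W (Suc j)"
    proof (rule well_formed_Edges)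
      fix i assume i: "i \<in> set [1..<length W]"
      then show "0 < i \<and> i < length W" by simp
      have "{W ! 0, W ! i} \<in> {{j, w} |w. w \<in> set (window v j)}"
        using i unfolding star[symmetric] by blast
      then show "{W ! 0, W ! i} \<notin> future_edges rest W (Suc j)"
        unfolding rest(1) by (rule new)
    qed (use rest(3) in simp_all)
    then show ?thesis
      using False j rest E star unfolding program
      by (auto simp: W[symmetric] future_edges_Edges future_verts_Edges simp del: upt_Suc)
  qed
qed

lemma card_trees_deleted:
  "int (card {F. F \<subseteq> {e \<in> edges (graph_power (path_graph n) 4). v \<notin> e} \<and> tree_on ({1..n} - {v}) F})
   = completions (program v 1 n) []"
proof -
  have E: "future_edges (program v 1 n) [] 1 = {e \<in> edges (graph_power (path_graph n) 4). v \<notin> e}"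
    and N: "future_verts (program v 1 n) 1 = {1..n} - {v}" and well_formed:
        "well_formed (program v 1 n) [] 1"
  proof -
    have w: "window v 1 = []" by (simp add: window_def)
    have "{e \<in> edges (graph_power (path_graph n) 4). v \<notin> e} =
        {{a, b} |a b. 1 \<le> a \<and> a < b \<and> b \<le> a + 4 \<and> 1 \<le> b \<and> b \<le> n \<and> a \<noteq> v \<and> b \<noteq> v}"
    proof -
      have "{e \<in> {{a, b} |a b. P a b}. v \<notin> e} = {{a, b} |a b. P a b \<and> a \<noteq> v \<and> b \<noteq> v}"
        for P :: "nat \<Rightarrow> nat \<Rightarrow> bool" by blast
      note this[of "\<lambda>a b. 1 \<le> a \<and> a < b \<and> b \<le> a + 4 \<and> b \<le> n"]
      then show ?thesis unfolding edges_power_path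
        by (elim trans) (intro Collect_cong ex_cong1, auto)
    qed
    then show "future_edges (program v 1 n) [] 1
        = {e \<in> edges (graph_power (path_graph n) 4). v \<notin> e}"
      "future_verts (program v 1 n) 1 = {1..n} - {v}" "well_formed (program v 1 n) [] 1"
      using program_correct[of 1 n v] unfolding w by simp_all
  qed
  have "int (card {S. S \<subseteq> future_edges (program v 1 n) [] 1
      \<and> tree_on ({} \<union> future_verts (program v 1 n) 1) ({} \<union> S)})
    = completions (program v 1 n) []"
    by (rule card_completions[OF well_formed]) (auto simp: frontier_def forest_def)
  then show ?thesis unfolding E N by simp
qed

theorem total_leaves_eq_completions:
  "int (total_leaves (graph_power (path_graph n) 4)) =
    (\<Sum>v = 1..n. int (min 4 (v - 1) + min 4 (n - v)) * completions (program v 1 n) [])"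
  by (subst total_leaves_eq)
    (simp_all add: simple_graph_graph_power simple_graph_path_graph verts_power_path
      vert_degree_power_path card_trees_deleted[unfolded One_nat_def])

section \<open>Power series of linear recurrences\<close>

lemma fps_mult_vanish:
  fixes F G :: "'a::comm_ring_1 fps"
  assumes "\<And>n. n > d \<Longrightarrow> F $ n = 0" "\<And>n. n > e \<Longrightarrow> G $ n = 0"
  shows "n > d + e \<Longrightarrow> (F * G) $ n = 0" "(F * G) $ (d + e) = F $ d * G $ e"
proof -
  show "(F * G) $ n = 0" if "n > d + e"
    unfolding fps_mult_nth
  proof (intro sum.neutral ballI)
    fix i assume "i \<in> {0..n}"
    with that have "i > d \<or> n - i > e" by auto
    then show "F $ i * G $ (n - i) = 0" using assms by auto
  qed
  have "(F * G) $ (d + e) = (\<Sum>i\<in>{d}. F $ i * G $ (d + e - i))"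
    unfolding fps_mult_nth
  proof (intro sum.mono_neutral_right ballI)
    fix i assume "i \<in> {0..d + e} - {d}"
    then have "i > d \<or> d + e - i > e" by auto
    then show "F $ i * G $ (d + e - i) = 0" using assms by auto
  qed auto
  then show "(F * G) $ (d + e) = F $ d * G $ e" by simp
qed

text \<open>
  For the double series \<open>b\<close> in the variables \<open>x\<close> and \<open>y\<close>, this is the result of setting \<open>x = y\<close>.
\<close>

definition diag :: "(nat \<Rightarrow> nat \<Rightarrow> 'a::comm_ring_1) \<Rightarrow> 'a fps" where
  "diag b = Abs_fps (\<lambda>m. \<Sum>i\<le>m. b i (m - i))"

lemma diag_swap: "diag (\<lambda>i j. b j i) = diag b"
proof (rule fps_ext)
  fix m
  show "diag (\<lambda>i j. b j i) $ m = diag b $ m"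
    unfolding diag_def fps_nth_Abs_fps
    by (rule sum.reindex_bij_witness[of _ "\<lambda>i. m - i" "\<lambda>i. m - i"]) auto
qed

text \<open>
  Setting \<open>x = y\<close> is multiplicative, so that multiplying by \<open>P\<close> can be done in the second
  variable alone.
\<close>

lemma mult_diag: "P * diag b = diag (\<lambda>i l. (P * Abs_fps (b i)) $ l)"
proof (rule fps_ext)
  fix m
  have cut: "sum f {..m - a} = (\<Sum>i\<le>m. if a + i \<le> m then f i else 0)" if "a \<le> m" for a and f ::
      "nat \<Rightarrow> 'a"
  proof -
    have "{..m - a} = {i \<in> {..m}. a + i \<le> m}" using that by auto
    then show ?thesis by (simp only: sum.inter_filter finite_atMost)
  qed
  have "(P * diag b) $ m = (\<Sum>a\<le>m. \<Sum>i\<le>m. if a + i \<le> m then P $ a * b i (m - a - i) else 0)"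
    unfolding diag_def fps_mult_nth atLeast0AtMost
  proof (intro sum.cong refl)
    fix a assume "a \<in> {..m}"
    then show "P $ a * (Abs_fps (\<lambda>m. \<Sum>i\<le>m. b i (m - i)) $ (m - a)) =
      (\<Sum>i\<le>m. if a + i \<le> m then P $ a * b i (m - a - i) else 0)"
      by (auto simp: sum_distrib_left cut intro!: sum.cong)
  qed
  also have "\<dots> = (\<Sum>i\<le>m. \<Sum>a\<le>m. if a + i \<le> m then P $ a * b i (m - a - i) else 0)"
    by (rule sum.swap)
  also have "\<dots> = diag (\<lambda>i l. (P * Abs_fps (b i)) $ l) $ m"
    unfolding diag_def fps_mult_nth fps_nth_Abs_fps atLeast0AtMost
  proof (rule sum.cong[OF refl])
    fix i assume "i \<in> {..m}"
    then have "(\<Sum>a\<le>m - i. P $ a * b i (m - i - a)) =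
        (\<Sum>a\<le>m. if i + a \<le> m then P $ a * b i (m - i - a) else 0)"
      by (intro cut) simp
    also have "\<dots> = (\<Sum>a\<le>m. if a + i \<le> m then P $ a * b i (m - a - i) else 0)"
      by (intro sum.cong) (auto simp: add.commute)
    finally show "(\<Sum>a\<le>m. if a + i \<le> m then P $ a * b i (m - a - i) else 0) =
      (\<Sum>a\<le>m - i. P $ a * b i (m - i - a))" by (rule sym)
  qed
  finally show "(P * diag b) $ m = diag (\<lambda>i l. (P * Abs_fps (b i)) $ l) $ m" .
qed

lemma diag_vanish:
  assumes "\<And>i j. i > d \<or> j > e \<Longrightarrow> b i j = 0"
  shows "m > d + e \<Longrightarrow> diag b $ m = 0" "diag b $ (d + e) = b d e"
proof -
  show "diag b $ m = 0" if "m > d + e"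
    unfolding diag_def fps_nth_Abs_fps
  proof (intro sum.neutral ballI)
    fix i
    have "i > d \<or> m - i > e" using that by auto
    then show "b i (m - i) = 0" by (rule assms)
  qed
  have "diag b $ (d + e) = (\<Sum>i\<in>{d}. b i (d + e - i))"
    unfolding diag_def fps_nth_Abs_fps
  proof (intro sum.mono_neutral_right ballI)
    fix i assume "i \<in> {..d + e} - {d}"
    then have "i > d \<or> d + e - i > e" by auto
    then show "b i (d + e - i) = 0" by (rule assms)
  qed auto
  then show "diag b $ (d + e) = b d e" by simp
qed

text \<open>
  The generating function of \<open>a\<close> is a fraction with denominator \<open>P\<close> and a numerator of degree
  less than \<open>d\<close>.
\<close>

definition annihilated :: "'a::comm_ring_1 fps \<Rightarrow> nat \<Rightarrow> (nat \<Rightarrow> 'a) \<Rightarrow> bool" where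
  "annihilated P d a \<longleftrightarrow> (\<forall>n\<ge>d. (P * Abs_fps a) $ n = 0)"

text \<open>
  One factor \<open>P\<close> clears the second variable and the other one, after exchanging the variables,
  the first.  What is left is a polynomial in both variables of degree at most \<open>d\<close> in each.
\<close>

lemma annihilated_double:
  fixes P :: "'a::comm_ring_1 fps"
  assumes row: "\<And>i. annihilated P (Suc d) (b i)" and col: "\<And>j. annihilated P (Suc d) (\<lambda>i. b i j)"
  shows "n > d + d \<Longrightarrow> (P * (P * diag b)) $ n = 0"
    and "(P * (P * diag b)) $ (d + d) =
      (\<Sum>i\<le>d. P $ (d - i) * (\<Sum>j\<le>d. P $ (d - j) * b i j))"
proof -
  \<comment> \<open>\<open>c\<close> is the double series after the first multiplication, with the variables exchanged.\<close>
  define c where "c = (\<lambda>j i. (P * Abs_fps (b i)) $ j)"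
  define e where "e = (\<lambda>j i. (P * Abs_fps (c j)) $ i)"
  have PP: "P * (P * diag b) = diag e"
    using diag_swap[of c] by (simp add: mult_diag c_def e_def)
  have c: "c j i = (\<Sum>a\<le>j. P $ a * b i (j - a))" for i j
    by (simp add: c_def fps_mult_nth atLeast0AtMost)
  have "e j i = 0" if "j > d \<or> i > d" for i j
  proof (cases "j > d")
    case True
    then have "c j = (\<lambda>_. 0)" using row by (auto simp: annihilated_def c_def)
    then show ?thesis by (simp add: e_def fps_mult_nth)
  next
    case False
    then have "i > d" using that by simp
    have "e j i = (\<Sum>k\<le>i. \<Sum>a\<le>j. P $ a * (P $ k * b (i - k) (j - a)))"
      by (simp add: e_def fps_mult_nth atLeast0AtMost c sum_distrib_left mult_ac)
    also have "\<dots> = (\<Sum>a\<le>j. P $ a * (P * Abs_fps (\<lambda>i. b i (j - a))) $ i)"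
      by (subst sum.swap) (simp add: fps_mult_nth atLeast0AtMost sum_distrib_left)
    also have "\<dots> = 0" using col \<open>i > d\<close> by (simp add: annihilated_def)
    finally show ?thesis .
  qed
  note v = diag_vanish[of d d e, OF this]
  show "n > d + d \<Longrightarrow> (P * (P * diag b)) $ n = 0" using v(1) by (simp add: PP)
  have rev: "(\<Sum>a\<le>d. P $ a * f (d - a)) = (\<Sum>i\<le>d. P $ (d - i) * f i)" for f
    by (rule sum.reindex_bij_witness[of _ "\<lambda>i. d - i" "\<lambda>i. d - i"]) auto
  show "(P * (P * diag b)) $ (d + d) = (\<Sum>i\<le>d. P $ (d - i) * (\<Sum>j\<le>d. P $ (d - j) * b i j))"
  proof -
    have "(P * (P * diag b)) $ (d + d) = e d d" by (simp only: PP v(2))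
    also have "\<dots> = (\<Sum>i\<le>d. P $ (d - i) * c d i)"
      by (simp add: e_def fps_mult_nth atLeast0AtMost rev)
    finally show ?thesis by (simp only: c rev)
  qed
qed

text \<open>
  A linear recurrence reads its coefficients in the opposite order to the product of power
  series; for palindromic coefficients this makes no difference.
\<close>

lemma annihilated_palindromic:
  fixes P :: "'a::comm_ring_1 fps"
  assumes deg: "\<And>n. n > d \<Longrightarrow> P $ n = 0" and pal: "\<And>i. i \<le> d \<Longrightarrow> P $ (d - i) = P $ i"
    and rec: "\<And>k. (\<Sum>i\<le>d. P $ i * a (k + i)) = 0"
  shows "annihilated P d a"
  unfolding annihilated_def
proof (intro allI impI)
  fix n assume n: "n \<ge> d"
  have "(P * Abs_fps a) $ n = (\<Sum>i\<le>d. P $ i * a (n - i))"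
    unfolding fps_mult_nth fps_nth_Abs_fps using n deg
    by (intro sum.mono_neutral_right) auto
  also have "\<dots> = (\<Sum>i\<le>d. P $ i * a (n - d + i))"
    by (rule sum.reindex_bij_witness[of _ "\<lambda>i. d - i" "\<lambda>i. d - i"]) (use n pal in auto)
  also have "\<dots> = 0" by (rule rec)
  finally show "(P * Abs_fps a) $ n = 0" .
qed

lemma fps_eq_poly_divide:
  fixes F P :: "'a::field fps"
  assumes "P \<noteq> 0" "\<And>n. n > d \<Longrightarrow> (P * F) $ n = 0" "(P * F) $ d \<noteq> 0"
  shows "\<exists>M. degree M = d \<and> F = fps_of_poly M / P"
proof (intro exI conjI)
  let ?M = "Abs_poly (\<lambda>n. (P * F) $ n)"
  have coeff: "coeff ?M n = (P * F) $ n" for n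
    by (rule fun_cong[OF coeff_Abs_poly[of d]]) (rule assms(2))
  show "degree ?M = d"
    by (intro antisym degree_le le_degree) (use assms(2,3) coeff in auto)
  have "fps_of_poly ?M = P * F" by (intro fps_ext) (simp only: fps_of_poly_nth coeff)
  also have "\<dots> = F * P" by (rule mult.commute)
  finally show "F = fps_of_poly ?M / P" using assms(1) by simp
qed

section \<open>Transfer matrices\<close>

text \<open>
  The states after a program, each as often as there are ways to reach it.
\<close>

fun outcomes :: "instr list \<Rightarrow> nat list \<Rightarrow> nat list list" where
  "outcomes [] c = [c]"
| "outcomes (x # os) c = concat (map (outcomes os) (moves x c))"

lemma completions_append: "completions (as @ bs) c
    = sum_list (map (completions bs) (outcomes as c))"
proof (induction "as" arbitrary: c)
  case (Cons x "as")
  have "completions (as @ bs) = (\<lambda>c'. sum_list (map (completions bs) (outcomes as c')))"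
    using Cons by blast
  moreover have "sum_list (map f (concat xss)) = sum_list (map (\<lambda>xs. sum_list (map f xs)) xss)"
    for f :: "nat list \<Rightarrow> int" and xss by (induction xss) auto
  ultimately show ?case by (simp add: comp_def)
qed simp

abbreviation dot :: "int list \<Rightarrow> int list \<Rightarrow> int" where
  "dot x y \<equiv> sum_list (map2 (*) x y)"

definition mat_vec :: "int list list \<Rightarrow> int list \<Rightarrow> int list" where
  "mat_vec A x = map (\<lambda>r. dot r x) A"

text \<open>
  The value \<open>p(A) x\<close> for the polynomial \<open>p\<close> with the given coefficients, constant term first.
\<close>

fun apply_poly :: "int list \<Rightarrow> int list list \<Rightarrow> int list \<Rightarrow> int list" where
  "apply_poly [] A x = map (\<lambda>_. 0) x"
| "apply_poly (a # p) A x = map2 (+) (map ((*) a) x) (apply_poly p A (mat_vec A x))"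

lemma length_mat_vec [simp]: "length (mat_vec A x) = length A"
  by (simp add: mat_vec_def)

lemma length_mat_vec_pow [simp]: "length x = length A \<Longrightarrow> length ((mat_vec A ^^ i) x) = length A"
  by (induction i) auto

lemma length_apply_poly [simp]: "length x = length A \<Longrightarrow> length (apply_poly p A x) = length A"
  by (induction p arbitrary: x) auto

lemma dot_eq_sum: "length x = n \<Longrightarrow> length y = n \<Longrightarrow> dot x y = (\<Sum>i<n. x ! i * y ! i)"
  by (simp add: sum_list_sum_nth lessThan_atLeast0)

lemma dot_zeros: "dot w (map (\<lambda>_. 0) x) = 0"
proof (induction w arbitrary: x)
  case (Cons a w)
  then show ?case by (cases x) auto
qed simp

lemma dot_add: "length x = length y \<Longrightarrow> dot w (map2 (+) x y) = dot w x + dot w y"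
proof (induction w arbitrary: x y)
  case (Cons a w)
  then show ?case by (cases x; cases y) (auto simp: algebra_simps)
qed simp

lemma dot_scale: "dot w (map ((*) a) x) = a * dot w x"
proof (induction w arbitrary: x)
  case (Cons b w)
  then show ?case by (cases x) (auto simp: algebra_simps)
qed simp

lemma dot_commute: "dot x y = dot y x"
proof (induction x arbitrary: y)
  case Nil
  then show ?case by (cases y) auto
next
  case (Cons a x)
  then show ?case by (cases y) auto
qed

lemma dot_apply_poly:
  "length x = length A \<Longrightarrow> dot w (apply_poly p A x)
      = (\<Sum>i<length p. p ! i * dot w ((mat_vec A ^^ i) x))"
proof (induction p arbitrary: x)
  case (Cons a p)
  have "dot w (apply_poly (a # p) A x) = a * dot w x + dot w (apply_poly p A (mat_vec A x))"
    using Cons.prems by (simp add: dot_add dot_scale)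
  also have "\<dots> = a * dot w x + (\<Sum>i<length p. p ! i * dot w ((mat_vec A ^^ i) (mat_vec A x)))"
    by (subst Cons.IH) simp_all
  also have "\<dots> = (\<Sum>i<length (a # p). (a # p) ! i * dot w ((mat_vec A ^^ i) x))"
    by (simp add: sum.lessThan_Suc_shift funpow_swap1 del: sum.lessThan_Suc)
  finally show ?case .
qed (simp add: dot_zeros)

definition adjoint :: "nat \<Rightarrow> int list list \<Rightarrow> int list list" where
  "adjoint n A = map (\<lambda>j. map (\<lambda>r. r ! j) A) [0..<n]"

lemma dot_mv_adjoint:
  assumes "\<And>r. r \<in> set A \<Longrightarrow> length r = n" "length x = length A" "length y = n"
  shows "dot x (mat_vec A y) = dot (mat_vec (adjoint n A) x) y"
proof -
  let ?m = "length A"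
  have "dot x (mat_vec A y) = (\<Sum>i<?m. x ! i * (\<Sum>j<n. A ! i ! j * y ! j))"
    using assms by (subst dot_eq_sum[where n = ?m]) (auto simp: mat_vec_def dot_eq_sum[where n
        = n] intro!: sum.cong)
  also have "\<dots> = (\<Sum>j<n. (\<Sum>i<?m. A ! i ! j * x ! i) * y ! j)"
    unfolding sum_distrib_left sum_distrib_right
    by (subst sum.swap) (simp add: mult_ac)
  also have "\<dots> = dot (mat_vec (adjoint n A) x) y"
    using assms
    by (subst dot_eq_sum[where n = n])
      (auto simp: mat_vec_def adjoint_def dot_eq_sum[where n = ?m] intro!: sum.cong)
  finally show ?thesis .
qed

lemma dot_mv_pow_adjoint:
  assumes "length A = n" "\<And>r. r \<in> set A \<Longrightarrow> length r = n" "length x = n" "length y = n"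
  shows "dot x ((mat_vec A ^^ i) y) = dot ((mat_vec (adjoint n A) ^^ i) x) y"
  using assms(3)
proof (induction i arbitrary: x)
  case (Suc i)
  have "dot x ((mat_vec A ^^ Suc i) y) = dot (mat_vec (adjoint n A) x) ((mat_vec A ^^ i) y)"
    using assms Suc.prems by (simp add: dot_mv_adjoint)
  also have "\<dots> = dot ((mat_vec (adjoint n A) ^^ Suc i) x) y"
    by (subst Suc.IH) (simp_all add: adjoint_def funpow_swap1)
  finally show ?case .
qed simp

definition count_vec :: "nat list list \<Rightarrow> instr list \<Rightarrow> int list" where
  "count_vec X os = map (completions os) X"

definition transfer_mat :: "nat list list \<Rightarrow> nat list list \<Rightarrow> instr list \<Rightarrow> int list list" where
  "transfer_mat X Y os = map (\<lambda>c. map (\<lambda>t. int (count_list (outcomes os c) t)) Y) X"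

text \<open>
  Stated with \<^const>\<open>list_all\<close> so that it can be decided by evaluation.
\<close>

definition sends :: "nat list list \<Rightarrow> nat list list \<Rightarrow> instr list \<Rightarrow> bool" where
  "sends X Y os \<longleftrightarrow> list_all (\<lambda>c. list_all (\<lambda>t. t \<in> set Y) (outcomes os c)) X"

lemma length_count_vec [simp]: "length (count_vec X os) = length X"
  by (simp add: count_vec_def)

lemma length_transfer_mat [simp]: "length (transfer_mat X Y os) = length X"
  by (simp add: transfer_mat_def)

lemma sum_list_map_count:
  fixes f :: "'a \<Rightarrow> int"
  assumes "set xs \<subseteq> set Y" "distinct Y"
  shows "sum_list (map f xs) = sum_list (map (\<lambda>s. int (count_list xs s) * f s) Y)"
  using assms(1)
proof (induction xs)
  case (Cons x xs)
  have "(\<Sum>s\<in>set Y. int (count_list (x # xs) s) * f s) =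
      (\<Sum>s\<in>set Y. int (count_list xs s) * f s + (if s = x then f s else 0))"
    by (intro sum.cong) (auto simp: algebra_simps)
  also have "\<dots> = (\<Sum>s\<in>set Y. int (count_list xs s) * f s) + f x"
    using Cons.prems by (simp add: sum.distrib)
  finally show ?case
    using Cons assms(2) by (simp add: sum_list_distinct_conv_sum_set)
qed simp

text \<open>
  A program acts on vectors of completion counts by a matrix whose entry at \<open>(s, t)\<close> is the
  number of ways to get from state \<open>s\<close> to state \<open>t\<close>.
\<close>

lemma count_vec_append:
  assumes "sends X Y as" "distinct Y"
  shows "count_vec X (as @ bs) = mat_vec (transfer_mat X Y as) (count_vec Y bs)"
proof -
  have "completions (as @ bs) c
      = dot (map (\<lambda>t. int (count_list (outcomes as c) t)) Y) (count_vec Y bs)"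
    if "c \<in> set X" for c
  proof -
    have "set (outcomes as c) \<subseteq> set Y" using assms(1) that by (auto simp: sends_def list_all_iff)
    then show ?thesis
      unfolding completions_append count_vec_def by (subst sum_list_map_count[OF _ assms(2)])
          (simp_all add: map2_map_map)
  qed
  then show ?thesis by (simp add: count_vec_def[of X] mat_vec_def transfer_mat_def)
qed

text \<open>
  The labels of a partition form a restricted growth string.  These are all fifteen of length
  four; the five of length three describe a window with the deleted vertex missing.
\<close>

definition states :: "nat list list" where
  "states = [[0,0,0,0], [0,0,0,1], [0,0,1,0], [0,0,1,1], [0,0,1,2], [0,1,0,0], [0,1,0,1],
     [0,1,0,2], [0,1,1,0], [0,1,1,1], [0,1,1,2], [0,1,2,0], [0,1,2,1], [0,1,2,2], [0,1,2,3]]"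

definition states3 :: "nat list list" where
  "states3 = [[0,0,0], [0,0,1], [0,1,0], [0,1,1], [0,1,2]]"

text \<open>
  The stage of a vertex whose window is full.
\<close>

definition step_prog :: "instr list" where
  "step_prog = [Vert, Edge 1, Edge 2, Edge 3, Edge 4, Drop]"

text \<open>
  A vertex whose window has only three entries, such as the fourth vertex of the path or one of
  the four vertices after a deleted inner vertex.
\<close>

definition fill_prog :: "instr list" where
  "fill_prog = [Vert, Edge 1, Edge 2, Edge 3]"

text \<open>
  The first three vertices.
\<close>

definition start_prog :: "instr list" where
  "start_prog = [Vert, Vert, Edge 1, Vert, Edge 1, Edge 2]"

definition steps :: "nat \<Rightarrow> instr list" where
  "steps i = concat (replicate i step_prog)"

definition steps3 :: "nat \<Rightarrow> instr list" where
  "steps3 i = concat (replicate i (fill_prog @ [Drop]))"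

definition step_mat :: "int list list" where
  "step_mat = [[4,0,0,0,0,0,0,0,0,1,0,0,0,0,0],
     [3,0,0,0,0,0,0,0,0,1,0,0,0,0,0],
     [3,3,0,0,0,0,0,0,1,0,1,0,0,0,0],
     [4,2,0,0,0,0,0,0,2,0,1,0,0,0,0],
     [2,2,0,0,0,0,0,0,1,0,1,0,0,0,0],
     [3,0,3,0,0,0,1,0,0,0,0,0,1,0,0],
     [4,0,2,0,0,0,2,0,0,0,0,0,1,0,0],
     [2,0,2,0,0,0,1,0,0,0,0,0,1,0,0],
     [4,0,0,2,0,2,0,0,0,0,0,0,0,1,0],
     [3,0,0,1,0,3,0,0,0,0,0,0,0,1,0],
     [2,0,0,1,0,2,0,0,0,0,0,0,0,1,0],
     [2,2,2,0,2,1,0,1,0,0,0,1,0,0,1],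
     [2,2,1,0,1,2,0,2,0,0,0,1,0,0,1],
     [2,1,2,0,1,2,0,1,0,0,0,2,0,0,1],
     [1,1,1,0,1,1,0,1,0,0,0,1,0,0,1]]"

definition step3_mat :: "int list list" where "step3_mat = transfer_mat states3 states3 (fill_prog
    @ [Drop])"
definition fill_mat :: "int list list" where "fill_mat = transfer_mat states3 states fill_prog"
definition drop_mat :: "int list list" where "drop_mat = transfer_mat states states3 [Drop]"
definition start_row :: "int list" where "start_row = hd (transfer_mat [[]] states3 start_prog)"
definition step_adj :: "int list list" where "step_adj = adjoint 15 step_mat"
definition first_row :: "int list" where "first_row = mat_vec (adjoint 15 fill_mat) start_row"

text \<open>
  The coefficients of \<open>Q\<close>, the product of the two factors of the denominator.
\<close>

definition recurrence :: "int list" where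
  "recurrence = [1, -7, 1, 25, -31, 52, 84, -300, 84, 52, -31, 25, 1, -7, 1]"

text \<open>
  A left eigenvector of \<^const>\<open>step_mat\<close> for the eigenvalue 1.  Orthogonality to it says that the
  completion counts \<open>f\<close> satisfy \<open>f 0001 + f 0010 + f 0100 + f 0111 = f 0011 + f 0101 + f 0110\<close>.
\<close>

definition relation :: "int list" where
  "relation = [0, 1, 1, -1, 0, 1, -1, 0, -1, 1, 0, 0, 0, 0, 0]"

lemma distinct_states: "distinct states" "distinct states3"
  by (simp_all add: states_def states3_def)

lemma sends_basic:
  "sends states states step_prog" "sends states3 states3 (fill_prog @ [Drop])"
  "sends states3 states fill_prog" "sends states states3 [Drop]" "sends [[]] states3 start_prog"
  by code_simp+

lemma step_mat_eq: "transfer_mat states states step_prog = step_mat"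
  by code_simp

text \<open>
  This column vector lies in the invariant subspace on which \<open>Q\<close> vanishes.
\<close>

lemma recurrence_final_col: "apply_poly recurrence step_mat (count_vec states []) = replicate 15 0"
  by code_simp

text \<open>
  This row vector does not: it has a component along the eigenvector \<^const>\<open>relation\<close>, the only
  obstruction to the recurrence \<open>Q\<close>.
\<close>

lemma recurrence_first_row: "apply_poly recurrence step_adj first_row = map ((*) (-50)) relation"
  by code_simp

lemma relation_step: "mat_vec step_adj relation = relation"
  by code_simp

text \<open>
  Counts for a program that begins with \<^const>\<open>Drop\<close> satisfy the relation: two states that
  become the same after the drop cancel in it.
\<close>

lemma relation_drop: "mat_vec (adjoint 5 drop_mat) relation = replicate 5 0"
  by code_simp

section \<open>Position of the deleted vertex\<close>

lemma completions_Skip: "completions (filter (\<lambda>x. x \<noteq> Skip) os) c = completions os c"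
proof (induction os arbitrary: c)
  case (Cons x os)
  then have "completions (filter (\<lambda>x. x \<noteq> Skip) os) = completions os" by blast
  then show ?case by (cases x) auto
qed simp

lemma completions_without_Skip: "filter (\<lambda>x. x \<noteq> Skip) os = os' \<Longrightarrow> completions os c
    = completions os' c"
  using completions_Skip[of os c] by simp

lemma program_split: "j \<le> k \<Longrightarrow> k \<le> Suc n \<Longrightarrow> program v j n = concat (map (stage v) [j..<k])
    @ program v k n"
  unfolding program_def by (metis concat_append le_Suc_ex map_append upt_add_eq_append)

lemma stage_far:
  assumes "5 \<le> j" "j < v \<or> v + 4 < j"
  shows "stage v j = step_prog"
proof -
  have "length (window v j) = 4" "j \<noteq> v" "j - 4 \<noteq> v" using assms by (auto simp: length_window)
  then show ?thesis using assms by (simp add: stage_def step_prog_def upt_rec)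
qed

lemma stages_far:
  assumes "5 \<le> j" "k \<le> v \<or> v + 4 < j"
  shows "concat (map (stage v) [j..<k]) = steps (k - j)"
proof -
  have "map (stage v) [j..<k] = map (\<lambda>_. step_prog) [j..<k]"
    using assms by (intro map_cong refl stage_far) auto
  then show ?thesis by (simp add: steps_def map_replicate_const)
qed

lemma filter_steps [simp]: "filter (\<lambda>x. x \<noteq> Skip) (steps i) = steps i"
  by (rule filter_True) (auto simp: steps_def step_prog_def)

lemma filter_steps3 [simp]: "filter (\<lambda>x. x \<noteq> Skip) (steps3 i) = steps3 i"
  by (rule filter_True) (auto simp: steps3_def fill_prog_def)

lemma steps3_Suc: "steps3 (Suc r) = steps3 r @ fill_prog @ [Drop]"
  by (induction r) (simp_all add: steps3_def)

text \<open>
  Spanning trees of the graph without vertex \<open>r + 1\<close>, where \<open>r < 4\<close>, without the vertex that is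
  \<open>r\<close> places before the last one, and without a vertex in between.  All are counted in terms of
  the number of full steps on either side of the hole.
\<close>

definition left_count :: "nat \<Rightarrow> nat \<Rightarrow> int" where
  "left_count r k = completions (start_prog @ steps3 r @ fill_prog @ steps k) []"

definition right_count :: "nat \<Rightarrow> nat \<Rightarrow> int" where
  "right_count r k = completions (start_prog @ fill_prog @ steps k @ [Drop] @ steps3 r) []"

definition inner_count :: "nat \<Rightarrow> nat \<Rightarrow> int" where
  "inner_count i j = completions (start_prog @ fill_prog @ steps i @ [Drop] @ steps3 3 @ fill_prog
      @ steps j) []"

lemma stages_start: "5 \<le> v \<Longrightarrow> concat (map (stage v) [1..<5]) = start_prog @ fill_prog"
  by (simp add: upt_rec stage_def length_window start_prog_def fill_prog_def)

lemma stages_hole: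
  assumes "5 \<le> v" "r \<le> 3"
  shows "filter (\<lambda>x. x \<noteq> Skip) (concat (map (stage v) [v..<v + Suc r])) = [Drop] @ steps3 r"
  using assms(2)
proof (induction r)
  case 0
  then show ?case using assms(1) by (simp add: stage_def steps3_def)
next
  case (Suc r)
  have "length (window v (v + Suc r)) = 3" using assms Suc.prems by (auto simp: length_window)
  then have "stage v (v + Suc r) = fill_prog @ [Drop]"
    using assms Suc.prems by (simp add: stage_def fill_prog_def upt_rec)
  moreover have "steps3 (Suc r) = steps3 r @ fill_prog @ [Drop]"
    by (simp only: steps3_Suc)
  ultimately show ?case using Suc by (simp add: fill_prog_def)
qed

lemma stage_last: "5 \<le> v \<Longrightarrow> stage v (v + 4) = fill_prog"
  by (simp add: stage_def length_window fill_prog_def upt_rec)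

text \<open>
  The vertices up to \<open>r + 5\<close> are close to the start or to the hole; all others are full steps.
\<close>

lemma completions_left:
  assumes "r < 4"
  shows "completions (program (Suc r) 1 (m + 8)) [] = left_count r (m + (3 - r))"
proof -
  let ?v = "Suc r"
  have "program ?v 1 (m + 8) = concat (map (stage ?v) [1..<r + 6]) @ program ?v (r + 6) (m + 8)"
    using assms by (intro program_split) auto
  also have "program ?v (r + 6) (m + 8) = steps (m + (3 - r))"
    unfolding program_def using assms by (subst stages_far) (auto intro: arg_cong[of _ _ steps])
  finally have "filter (\<lambda>x. x \<noteq> Skip) (program ?v 1 (m + 8)) =
    filter (\<lambda>x. x \<noteq> Skip) (concat (map (stage ?v) [1..<r + 6])) @ steps (m + (3 - r))" by simp
  moreover have "filter (\<lambda>x. x \<noteq> Skip) (concat (map (stage ?v) [1..<r + 6])) = start_prog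
      @ steps3 r @ fill_prog"
  proof -
    consider "r = 0" | "r = 1" | "r = 2" | "r = 3" using assms by linarith
    then show ?thesis
      by cases (simp_all add: upt_rec stage_def length_window start_prog_def steps3_def fill_prog_def numeral_eq_Suc)
  qed
  ultimately show ?thesis unfolding left_count_def by (intro completions_without_Skip) simp
qed

lemma completions_right:
  assumes "r < 4"
  shows "completions (program (m + 8 - r) 1 (m + 8)) [] = right_count r (m + (3 - r))"
proof -
  let ?v = "m + 8 - r"
  have "program ?v 1 (m + 8) = concat (map (stage ?v) [1..<5]) @ concat (map (stage ?v) [5..<?v])
      @ concat (map (stage ?v) [?v..<?v + Suc r])"
    using assms program_split[of 1 5 "m + 8" ?v] program_split[of 5 ?v "m + 8" ?v] by
        (simp add: program_def)
  also have "concat (map (stage ?v) [5..<?v]) = steps (m + (3 - r))"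
    using assms by (subst stages_far) (auto intro: arg_cong[of _ _ steps])
  also have "concat (map (stage ?v) [1..<5]) = start_prog @ fill_prog"
    using assms by (intro stages_start) auto
  finally show ?thesis
    unfolding right_count_def using assms stages_hole[of ?v r]
    by (intro completions_without_Skip) (simp add: start_prog_def fill_prog_def)
qed

lemma completions_inner: "completions (program (i + 5) 1 (i + j + 9)) [] = inner_count i j"
proof -
  let ?v = "i + 5" and ?n = "i + j + 9"
  have "program ?v 1 ?n = concat (map (stage ?v) [1..<5]) @ concat (map (stage ?v) [5..<?v])
      @ concat (map (stage ?v) [?v..<?v + Suc 3]) @ concat (map (stage ?v) [?v + 4..<?v + 5])
      @ concat (map (stage ?v) [?v + 5..<Suc ?n])"
    using program_split[of 1 5 ?n ?v] program_split[of 5 ?v ?n ?v] program_split[of ?v "?v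
        + 4" ?n ?v]
      program_split[of "?v + 4" "?v + 5" ?n ?v] by (simp add: program_def)
  also have "concat (map (stage ?v) [5..<?v]) = steps i"
    by (subst stages_far) auto
  also have "concat (map (stage ?v) [1..<5]) = start_prog @ fill_prog"
    by (intro stages_start) auto
  also have "concat (map (stage ?v) [?v + 4..<?v + 5]) = fill_prog"
    using stage_last[of ?v] by (simp add: upt_rec)
  also have "concat (map (stage ?v) [?v + 5..<Suc ?n]) = steps j"
    by (subst stages_far) auto
  finally show ?thesis
    unfolding inner_count_def using stages_hole[of ?v 3]
    by (intro completions_without_Skip) (simp add: start_prog_def fill_prog_def)
qed

text \<open>
  Deleting one of the four vertices at either end; the weights 4 to 7 are the degrees.
\<close>

definition boundary_count :: "nat \<Rightarrow> int" where
  "boundary_count m = (\<Sum>r<4. int (4 + r) * (left_count r (m + (3 - r)) + right_count r (m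
      + (3 - r))))"

text \<open>
  From \<open>n = 8\<close> on the first four and the last four vertices are disjoint, so that the vertex
  \<open>r < 4\<close> places from an end has degree \<open>4 + r\<close> and all vertices between have degree 8.
\<close>

lemma total_leaves_split:
  "int (total_leaves (graph_power (path_graph (m + 8)) 4)) =
    boundary_count m + 8 * (\<Sum>i<m. inner_count i (m - 1 - i))"
proof -
  let ?n = "m + 8"
  define f where "f = (\<lambda>v. int (min 4 (v - 1) + min 4 (?n - v)) * completions (program v 1 ?n) [])"
  have "{1..?n} = Suc ` {..<4} \<union> (\<lambda>i. i + 5) ` {..<m} \<union> (\<lambda>r. ?n - r) ` {..<4}"
  proof (intro equalityI subsetI)
    fix v assume v: "v \<in> {1..?n}"
    consider "v \<le> 4" | "5 \<le> v" "v \<le> m + 4" | "m + 5 \<le> v" by linarith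
    then show "v \<in> Suc ` {..<4} \<union> (\<lambda>i. i + 5) ` {..<m} \<union> (\<lambda>r. ?n - r) ` {..<4}"
    proof cases
      case 1
      then show ?thesis using v by (intro UnI1 image_eqI[of _ _ "v - 1"]) auto
    next
      case 2
      then show ?thesis by (intro UnI1 UnI2 image_eqI[of _ _ "v - 5"]) auto
    next
      case 3
      then show ?thesis using v by (intro UnI2 image_eqI[of _ _ "?n - v"]) auto
    qed
  qed auto
  then have "(\<Sum>v = 1..?n. f v) =
      sum f (Suc ` {..<4} \<union> (\<lambda>i. i + 5) ` {..<m} \<union> (\<lambda>r. ?n - r) ` {..<4})" by simp
  also have "\<dots> = sum f (Suc ` {..<4} \<union> (\<lambda>i. i + 5) ` {..<m}) + sum f ((\<lambda>r. ?n - r) ` {..<4})"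
    by (rule sum.union_disjoint) auto
  also have "sum f (Suc ` {..<4} \<union> (\<lambda>i. i + 5) ` {..<m}) =
      sum f (Suc ` {..<4}) + sum f ((\<lambda>i. i + 5) ` {..<m})"
    by (rule sum.union_disjoint) auto
  also have "sum f (Suc ` {..<4}) = (\<Sum>r<4. f (Suc r))"
    by (subst sum.reindex) auto
  also have "sum f ((\<lambda>i. i + 5) ` {..<m}) = (\<Sum>i<m. f (i + 5))"
    by (subst sum.reindex) (auto simp: inj_on_def)
  also have "sum f ((\<lambda>r. ?n - r) ` {..<4}) = (\<Sum>r<4. f (?n - r))"
    by (subst sum.reindex) (auto simp: inj_on_def)
  also have "(\<Sum>r<4. f (Suc r)) = (\<Sum>r<4. int (4 + r) * left_count r (m + (3 - r)))"
    using completions_left by (intro sum.cong) (auto simp: f_def)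
  also have "(\<Sum>r<4. f (?n - r)) = (\<Sum>r<4. int (4 + r) * right_count r (m + (3 - r)))"
    using completions_right by (intro sum.cong) (auto simp: f_def)
  also have "(\<Sum>i<m. f (i + 5)) = (\<Sum>i<m. 8 * inner_count i (m - 1 - i))"
  proof (intro sum.cong refl)
    fix i assume "i \<in> {..<m}"
    then have n: "i + (m - 1 - i) + 9 = ?n" by auto
    have "completions (program (i + 5) 1 ?n) [] = inner_count i (m - 1 - i)"
      using completions_inner[of i "m - 1 - i"] unfolding n .
    then show "f (i + 5) = 8 * inner_count i (m - 1 - i)"
      using \<open>i \<in> _\<close> by (simp add: f_def)
  qed
  finally show ?thesis
    by (simp add: total_leaves_eq_completions f_def boundary_count_def sum.distrib distrib_left sum_distrib_left)
qed

text \<open>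
  The unit vector of the partition with a single block, the only complete one.
\<close>

definition final_col :: "int list" where "final_col = count_vec states []"

definition right_col :: "nat \<Rightarrow> int list" where
  "right_col r = mat_vec drop_mat ((mat_vec step3_mat ^^ r) (count_vec states3 []))"

definition left_row :: "nat \<Rightarrow> int list" where
  "left_row r = mat_vec (adjoint 15 fill_mat) ((mat_vec (adjoint 5 step3_mat) ^^ r) start_row)"

lemma lengths [simp]:
  "length states = 15" "length states3 = 5" "length step_mat = 15" "length step_adj = 15"
      "length step3_mat = 5" "length fill_mat = 5"
  "length drop_mat = 15" "length start_row = 5" "length first_row = 15" "length final_col = 15"
      "length (right_col r) = 15" "length (left_row r) = 15"
  by (simp_all add: states_def states3_def step_mat_def step3_mat_def fill_mat_def drop_mat_def
      start_row_def transfer_mat_def first_row_def step_adj_def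
      adjoint_def final_col_def right_col_def left_row_def)

lemma row_lengths [simp]:
  "r \<in> set step_mat \<Longrightarrow> length r = 15" "r \<in> set step3_mat \<Longrightarrow> length r = 5" "r \<in> set fill_mat
      \<Longrightarrow> length r = 15"
  "r \<in> set drop_mat \<Longrightarrow> length r = 5"
  by (auto simp: step_mat_def step3_mat_def fill_mat_def drop_mat_def transfer_mat_def states_def states3_def)

lemma count_vec_steps: "count_vec states (steps i @ os)
    = (mat_vec step_mat ^^ i) (count_vec states os)"
  by (induction i) (simp_all add: steps_def count_vec_append[OF sends_basic(1) distinct_states(1)] step_mat_eq)

lemma count_vec_steps3: "count_vec states3 (steps3 i @ os)
    = (mat_vec step3_mat ^^ i) (count_vec states3 os)"
proof (induction i)
  case (Suc i)
  have "steps3 (Suc i) @ os = (fill_prog @ [Drop]) @ (steps3 i @ os)" by (simp add: steps3_def)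
  then show ?case
    using count_vec_append[OF sends_basic(2) distinct_states(2)] Suc by
        (simp only: step3_mat_def funpow.simps comp_apply)
qed (simp add: steps3_def)

lemma count_vec_fill: "count_vec states3 (fill_prog @ os) = mat_vec fill_mat (count_vec states os)"
  by (simp add: fill_mat_def count_vec_append[OF sends_basic(3) distinct_states(1)])

lemma count_vec_Drop: "count_vec states ([Drop] @ os) = mat_vec drop_mat (count_vec states3 os)"
  unfolding drop_mat_def by (rule count_vec_append[OF sends_basic(4) distinct_states(2)])

lemma completions_start: "completions (start_prog @ os) [] = dot start_row (count_vec states3 os)"
proof -
  have "count_vec [[]] (start_prog @ os)
      = mat_vec (transfer_mat [[]] states3 start_prog) (count_vec states3 os)"
    by (rule count_vec_append[OF sends_basic(5) distinct_states(2)])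
  then show ?thesis by (simp add: start_row_def count_vec_def[of
      "[[]]"] mat_vec_def transfer_mat_def)
qed

lemma left_count_eq: "left_count r k = dot (left_row r) ((mat_vec step_mat ^^ k) final_col)"
proof -
  have "left_count r k = dot start_row ((mat_vec step3_mat ^^ r) (mat_vec fill_mat ((mat_vec step_mat ^^ k) final_col)))"
    unfolding left_count_def final_col_def completions_start count_vec_steps3 count_vec_fill
        using count_vec_steps[of k "[]"] by simp
  also have "\<dots> = dot ((mat_vec (adjoint 5 step3_mat) ^^ r) start_row) (mat_vec fill_mat ((mat_vec step_mat ^^ k) final_col))"
    by (subst dot_mv_pow_adjoint[where n = 5]) auto
  also have "\<dots> = dot (left_row r) ((mat_vec step_mat ^^ k) final_col)"
    unfolding left_row_def by (rule dot_mv_adjoint) (auto simp: adjoint_def)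
  finally show ?thesis .
qed

lemma completions_first: "completions (start_prog @ fill_prog @ os) []
    = dot first_row (count_vec states os)"
  unfolding completions_start count_vec_fill first_row_def by (rule dot_mv_adjoint) auto

lemma completions_first_steps:
  "completions (start_prog @ fill_prog @ steps i @ os) []
      = dot (count_vec states os) ((mat_vec step_adj ^^ i) first_row)"
proof -
  have "completions (start_prog @ fill_prog @ steps i @ os) []
      = dot first_row ((mat_vec step_mat ^^ i) (count_vec states os))"
    by (simp add: completions_first count_vec_steps)
  also have "\<dots> = dot ((mat_vec step_adj ^^ i) first_row) (count_vec states os)"
    unfolding step_adj_def by (rule dot_mv_pow_adjoint) auto
  finally show ?thesis by (simp add: dot_commute)
qed

lemma right_count_eq: "right_count r k = dot (right_col r) ((mat_vec step_adj ^^ k) first_row)"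
  unfolding right_count_def completions_first_steps count_vec_Drop right_col_def
      using count_vec_steps3[of r "[]"] by simp

text \<open>
  The passage through the deleted vertex: three windows of size three before the window is full
  again.
\<close>

definition hole_map :: "int list \<Rightarrow> int list" where
  "hole_map x = mat_vec drop_mat ((mat_vec step3_mat ^^ 3) (mat_vec fill_mat x))"

definition hole_adj :: "int list \<Rightarrow> int list" where
  "hole_adj x = mat_vec (adjoint 15 fill_mat) ((mat_vec (adjoint 5 step3_mat) ^^ 3) (mat_vec (adjoint 5 drop_mat) x))"

lemma dot_hole_map: "length x = 15 \<Longrightarrow> length z = 15 \<Longrightarrow> dot x (hole_map z) = dot (hole_adj x) z"
  unfolding hole_map_def hole_adj_def
  by (subst dot_mv_adjoint[where n = 5], auto,
      subst dot_mv_pow_adjoint[where n = 5], auto simp: adjoint_def,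
      subst dot_mv_adjoint[where n = 15], auto simp: adjoint_def)

lemma inner_count_eq: "inner_count i j
    = dot (hole_map ((mat_vec step_mat ^^ j) final_col)) ((mat_vec step_adj ^^ i) first_row)"
  unfolding inner_count_def completions_first_steps count_vec_Drop count_vec_steps3 count_vec_fill hole_map_def final_col_def
  using count_vec_steps[of j "[]"] by simp

lemma inner_count_eq_adj: "inner_count i j
    = dot (hole_adj ((mat_vec step_adj ^^ i) first_row)) ((mat_vec step_mat ^^ j) final_col)"
  unfolding inner_count_eq by (subst dot_commute, rule dot_hole_map) auto

lemma length_recurrence [simp]: "length recurrence = 15" by (simp add: recurrence_def)

lemma dot_zero_right: "dot x (replicate n 0) = 0"
  using dot_zeros[of x "replicate n (0::nat)"] by (simp add: map_replicate)

text \<open>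
  The powers of the matrix before the recurrence starts can be moved to the row vector, so one
  evaluation of \<open>Q\<close> at the column \<^const>\<open>final_col\<close> suffices.
\<close>

lemma recurrence_col: "(\<Sum>i<15. recurrence ! i * dot x ((mat_vec step_mat ^^ (k + i)) final_col))
    = 0" if "length x = 15"
proof -
  have "(\<Sum>i<15. recurrence ! i * dot x ((mat_vec step_mat ^^ (k + i)) final_col)) =
      (\<Sum>i<15. recurrence ! i * dot ((mat_vec step_adj ^^ k) x) ((mat_vec step_mat ^^ i) final_col))"
  proof (intro sum.cong refl)
    fix i
    have "dot x ((mat_vec step_mat ^^ (k + i)) final_col)
        = dot x ((mat_vec step_mat ^^ k) ((mat_vec step_mat ^^ i) final_col))"
      by (simp add: funpow_add)
    also have "\<dots> = dot ((mat_vec step_adj ^^ k) x) ((mat_vec step_mat ^^ i) final_col)"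
      unfolding step_adj_def by (rule dot_mv_pow_adjoint) (use that in auto)
    finally show "recurrence ! i * dot x ((mat_vec step_mat ^^ (k + i)) final_col)
        = recurrence ! i * dot ((mat_vec step_adj ^^ k) x) ((mat_vec step_mat ^^ i) final_col)"
      by simp
  qed
  also have "\<dots> = dot ((mat_vec step_adj ^^ k) x) (apply_poly recurrence step_mat final_col)"
    by (subst dot_apply_poly) auto
  also have "\<dots> = 0" unfolding final_col_def recurrence_final_col by (rule dot_zero_right)
  finally show ?thesis .
qed

text \<open>
  As before with rows and columns exchanged.  Evaluating \<open>Q\<close> leaves a multiple of
  \<^const>\<open>relation\<close>, which vanishes against \<open>x\<close> and, by its invariance, against all later vectors.
\<close>

lemma recurrence_row:
  assumes "length x = 15" "dot relation x = 0"
  shows "(\<Sum>i<15. recurrence ! i * dot x ((mat_vec step_adj ^^ (k + i)) first_row)) = 0"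
proof -
  \<comment> \<open>The relation is a left eigenvector for the eigenvalue 1, so powers of the matrix keep it.\<close>
  have pow: "dot relation ((mat_vec step_mat ^^ k) x) = dot relation x"
  proof (induction k)
    case (Suc k)
    have "dot relation ((mat_vec step_mat ^^ Suc k) x)
        = dot (mat_vec step_adj relation) ((mat_vec step_mat ^^ k) x)"
      unfolding step_adj_def using assms by (simp, intro dot_mv_adjoint) (auto simp: relation_def)
    then show ?case using Suc by (simp add: relation_step)
  qed simp
  have "(\<Sum>i<15. recurrence ! i * dot x ((mat_vec step_adj ^^ (k + i)) first_row)) =
      (\<Sum>i<15. recurrence ! i * dot ((mat_vec step_mat ^^ k) x) ((mat_vec step_adj ^^ i) first_row))"
  proof (intro sum.cong refl)
    fix i
    have "dot x ((mat_vec step_adj ^^ (k + i)) first_row)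
        = dot ((mat_vec step_adj ^^ k) ((mat_vec step_adj ^^ i) first_row)) x"
      by (simp add: funpow_add dot_commute)
    also have "\<dots> = dot ((mat_vec step_adj ^^ i) first_row) ((mat_vec step_mat ^^ k) x)"
      unfolding step_adj_def by (rule dot_mv_pow_adjoint[symmetric]) (use assms in \<open>auto simp:
          adjoint_def\<close>)
    finally show "recurrence ! i * dot x ((mat_vec step_adj ^^ (k + i)) first_row)
        = recurrence ! i * dot ((mat_vec step_mat ^^ k) x) ((mat_vec step_adj ^^ i) first_row)"
      by (simp add: dot_commute)
  qed
  also have "\<dots> = dot ((mat_vec step_mat ^^ k) x) (apply_poly recurrence step_adj first_row)"
    by (subst dot_apply_poly) auto
  also have "\<dots> = -50 * dot relation ((mat_vec step_mat ^^ k) x)"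
    unfolding recurrence_first_row dot_scale by (simp add: dot_commute)
  also have "\<dots> = 0" using pow assms by simp
  finally show ?thesis .
qed

lemma relation_drop_mat: "length x = 5 \<Longrightarrow> dot relation (mat_vec drop_mat x) = 0"
  by (subst dot_mv_adjoint[where n = 5])
      (auto simp: relation_def[symmetric] relation_drop dot_commute dot_zero_right, simp add: relation_def)

lemma recurrence_left: "(\<Sum>i<15. recurrence ! i * left_count r (k + i)) = 0"
  unfolding left_count_eq by (rule recurrence_col) simp

lemma recurrence_right: "(\<Sum>i<15. recurrence ! i * right_count r (k + i)) = 0"
  unfolding right_count_eq by (rule recurrence_row)
      (auto simp: right_col_def intro!: relation_drop_mat)

lemma recurrence_inner_snd: "(\<Sum>i<15. recurrence ! i * inner_count i' (k + i)) = 0"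
  unfolding inner_count_eq_adj by (rule recurrence_col) (simp add: hole_adj_def adjoint_def)

lemma recurrence_inner_fst: "(\<Sum>i<15. recurrence ! i * inner_count (k + i) j) = 0"
  unfolding inner_count_eq by (rule recurrence_row)
      (auto simp: hole_map_def intro!: relation_drop_mat)

lemma recurrence_boundary: "(\<Sum>i<15. recurrence ! i * boundary_count (k + i)) = 0"
proof -
  have "(\<Sum>i<15. recurrence ! i * boundary_count (k + i)) = (\<Sum>r<4. int (4 + r) *
      ((\<Sum>i<15. recurrence ! i * left_count r ((k + (3 - r)) + i))
          + (\<Sum>i<15. recurrence ! i * right_count r ((k + (3 - r)) + i))))"
    unfolding boundary_count_def sum_distrib_left sum.distrib[symmetric]
    by (subst sum.swap) (simp add: algebra_simps)
  then show ?thesis by (simp only: recurrence_left recurrence_right) simp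
qed

text \<open>
  The coefficients \<open>1\<close> to \<open>14\<close> of \<open>Q\<close>.  As \<open>Q\<close> is palindromic they are also those from \<open>13\<close> down
  to \<open>0\<close>, which enter the coefficient at 13 of a product with \<open>Q\<close>.
\<close>

definition tail_coeffs :: "int list" where "tail_coeffs = tl recurrence"

lemma length_tail_coeffs [simp]: "length tail_coeffs = 14" by (simp add: tail_coeffs_def)

lemma coeff_left: "(\<Sum>i<14. tail_coeffs ! i * left_count r (i + e))
    = dot (left_row r) (apply_poly tail_coeffs step_mat ((mat_vec step_mat ^^ e) final_col))"
  unfolding left_count_eq by (subst dot_apply_poly) (auto simp: funpow_add)

lemma coeff_right: "(\<Sum>i<14. tail_coeffs ! i * right_count r (i + e))
    = dot (right_col r) (apply_poly tail_coeffs step_adj ((mat_vec step_adj ^^ e) first_row))"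
  unfolding right_count_eq by (subst dot_apply_poly) (auto simp: funpow_add)

lemma coeff_boundary: "(\<Sum>i<14. tail_coeffs ! i * boundary_count i) = (\<Sum>r<4. int (4 + r) *
    (dot (left_row r) (apply_poly tail_coeffs step_mat ((mat_vec step_mat ^^ (3 - r)) final_col))
        + dot (right_col r) (apply_poly tail_coeffs step_adj ((mat_vec step_adj ^^ (3 - r)) first_row))))"
  unfolding boundary_count_def sum_distrib_left coeff_left[symmetric] coeff_right[symmetric] sum.distrib[symmetric]
  by (subst sum.swap) (simp add: algebra_simps)

text \<open>
  Both sums are evaluated as polynomials in the matrix, one on each side of the hole.
\<close>

lemma coeff_inner: "(\<Sum>i<14. tail_coeffs ! i * (\<Sum>j<14. tail_coeffs ! j * inner_count i j)) =
    dot (hole_map (apply_poly tail_coeffs step_mat final_col)) (apply_poly tail_coeffs step_adj first_row)"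
proof -
  have "(\<Sum>j<14. tail_coeffs ! j * inner_count i j)
      = dot (hole_map (apply_poly tail_coeffs step_mat final_col)) ((mat_vec step_adj ^^ i) first_row)" for i
  proof -
    have "(\<Sum>j<14. tail_coeffs ! j * inner_count i j)
        = dot (hole_adj ((mat_vec step_adj ^^ i) first_row)) (apply_poly tail_coeffs step_mat final_col)"
      unfolding inner_count_eq_adj by (subst dot_apply_poly) auto
    also have "\<dots> = dot ((mat_vec step_adj ^^ i) first_row) (hole_map (apply_poly tail_coeffs step_mat final_col))"
      by (rule dot_hole_map[symmetric]) auto
    also have "\<dots> = dot (hole_map (apply_poly tail_coeffs step_mat final_col)) ((mat_vec step_adj ^^ i) first_row)"
      by (rule dot_commute)
    finally show ?thesis .
  qed
  then show ?thesis by (subst dot_apply_poly) auto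
qed

section \<open>The leading coefficient\<close>

text \<open>
  A path of seven vertices is too short for the splitting into ends and middle, so this value
  is computed from the programs.
\<close>

lemma total_leaves_7: "int (total_leaves (graph_power (path_graph 7) 4)) = 18360"
proof -
  have "int (total_leaves (graph_power (path_graph 7) 4)) =
    sum_list (map (\<lambda>v. int (min 4 (v - 1)
        + min 4 (7 - v)) * completions (program v 1 7) []) [1..<8])"
    by (subst total_leaves_eq_completions)
        (simp_all add: sum_list_distinct_conv_sum_set atLeastLessThanSuc_atLeastAtMost[symmetric] eval_nat_numeral del: upt_Suc)
  also have "\<dots> = 18360" by code_simp
  finally show ?thesis .
qed

definition tail_col :: "nat \<Rightarrow> int list" where
  "tail_col r = apply_poly tail_coeffs step_mat ((mat_vec step_mat ^^ (3 - r)) final_col)"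

definition tail_row :: "nat \<Rightarrow> int list" where
  "tail_row r = apply_poly tail_coeffs step_adj ((mat_vec step_adj ^^ (3 - r)) first_row)"

lemma right_col_eq: "map right_col [0, 1, 2, 3] =
     [[1,0,0,0,0,0,0,0,0,0,0,0,0,0,0],
      [3,0,2,2,0,2,2,0,2,2,0,1,1,1,0],
      [11,0,8,8,0,13,13,0,13,13,0,8,8,8,0],
      [46,0,35,35,0,59,59,0,64,64,0,40,40,40,0]]"
  by code_simp

lemma left_row_eq: "map left_row [0, 1, 2, 3] =
     [[16,3,3,1,1,3,1,1,1,3,1,1,1,1,1],
      [75,11,11,4,3,11,4,3,4,16,4,3,4,4,3],
      [336,41,41,20,11,51,15,11,15,75,15,11,15,20,11],
      [1488,168,178,90,46,226,66,46,61,336,61,46,66,90,46]]"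
  by code_simp

lemma tail_col_eq: "map tail_col [0, 1, 2, 3] =
     [[-19,-15,-27,-32,-20,-27,-32,-20,-32,-27,-20,-32,-32,-32,-20],
      [-4,-3,-3,-4,-2,-3,-4,-2,-4,-3,-2,-2,-2,-2,-1],
      [-1,0,0,0,0,0,0,0,0,0,0,0,0,0,0],
      [-1,1,1,2,-1,1,2,-1,2,3,-2,-1,-2,-2,1]]"
  by code_simp

lemma tail_row_eq: "map tail_row [0, 1, 2, 3] =
     [[-864,-158,-158,14,-24,-158,14,-24,14,-194,-30,-24,-30,-30,-19],
      [-125,-69,-69,44,-5,-69,44,-5,44,-69,-5,-5,-5,-5,-4],
      [-16,-53,-53,49,-1,-53,49,-1,49,-53,-1,-1,-1,-1,-1],
      [0,-53,-50,50,-1,-50,50,-1,50,-50,-1,0,0,0,-1]]"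
  by code_simp

text \<open>
  Multiplied by the step matrix, this column becomes \<open>-\<close>\<^const>\<open>final_col\<close>, because \<open>Q\<close> has
  constant term 1 and kills \<^const>\<open>final_col\<close>.  That the passage through the hole maps it to
  zero makes the inner vertices contribute nothing to the leading coefficient.
\<close>

lemma hole_tail_col: "hole_map (tail_col 3) = replicate 15 0"
proof -
  have "tail_col 3 = [-1,1,1,2,-1,1,2,-1,2,3,-2,-1,-2,-2,1]" using tail_col_eq by simp
  then show ?thesis by (simp only:) code_simp
qed

text \<open>
  The three terms are the contributions of \<open>L\<^sub>7 t\<close>, of the end vertices and of the inner
  vertices to the coefficient at 29 of the numerator.
\<close>

lemma leading_coefficient:
  "18360 + (\<Sum>i<14. tail_coeffs ! i * boundary_count i)
      + 8 * (\<Sum>i<14. tail_coeffs ! i * (\<Sum>j<14. tail_coeffs ! j * inner_count i j)) = 2016"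
proof -
  have inner_count: "(\<Sum>i<14. tail_coeffs ! i * (\<Sum>j<14. tail_coeffs ! j * inner_count i j)) = 0"
    using hole_tail_col by (simp add: coeff_inner tail_col_def dot_commute dot_zero_right)
  have "(\<Sum>i<14. tail_coeffs ! i * boundary_count i) =
      (\<Sum>r<4. int (4 + r) * (dot (left_row r) (tail_col r) + dot (right_col r) (tail_row r)))"
    by (simp add: coeff_boundary tail_col_def tail_row_def)
  also have "\<dots> = sum_list (map (\<lambda>r. int (4 + r) * (dot (left_row r) (tail_col r)
      + dot (right_col r) (tail_row r))) [0, 1, 2, 3])"
    by (simp add: eval_nat_numeral)
  also have "\<dots> = - 16344"
    using right_col_eq left_row_eq tail_col_eq tail_row_eq by simp
  finally show ?thesis using inner_count by simp
qed

section \<open>The generating function\<close>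

definition recurrence_fps :: "rat fps" where
  "recurrence_fps = fps_of_poly (Poly (map of_int recurrence))"

lemma recurrence_fps_nth: "recurrence_fps $ n = (if n < 15 then of_int (recurrence ! n) else 0)"
  by (simp add: recurrence_fps_def nth_default_def)

lemma recurrence_palindromic: "i \<le> 14 \<Longrightarrow> recurrence ! (14 - i) = recurrence ! i"
  and tail_coeffs_nth: "i \<le> 13 \<Longrightarrow> recurrence ! (13 - i) = tail_coeffs ! i"
proof -
  have "list_all (\<lambda>i. recurrence ! (14 - i) = recurrence ! i) [0..<15]" by code_simp
  then show "i \<le> 14 \<Longrightarrow> recurrence ! (14 - i) = recurrence ! i" by (simp add: list_all_iff)
  have "list_all (\<lambda>i. recurrence ! (13 - i) = tail_coeffs ! i) [0..<14]" by code_simp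
  then show "i \<le> 13 \<Longrightarrow> recurrence ! (13 - i) = tail_coeffs ! i" by (simp add: list_all_iff)
qed

lemma denominator:
  "(fps_X ^ 6 - 3 * fps_X ^ 5 + 6 * fps_X ^ 4 - 10 * fps_X ^ 3 + 6 * fps_X ^ 2 - 3 * fps_X + 1) *
   (fps_X ^ 8 - 4 * fps_X ^ 7 - 17 * fps_X ^ 6 + 8 * fps_X ^ 5 + 49 * fps_X ^ 4
      + 8 * fps_X ^ 3 - 17 * fps_X ^ 2 - 4 * fps_X + 1) = recurrence_fps" (is "?A * ?B = _")
proof -
  have A: "?A = fps_of_poly [:1, -3, 6, -10, 6, -3, 1:]"
    by (simp add: fps_of_poly_pCons numeral_fps_const[symmetric] fps_const_neg[symmetric] del: fps_const_neg)
      (simp add: eval_nat_numeral monom_Suc monom_0)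
  have B: "?B = fps_of_poly [:1, -4, -17, 8, 49, 8, -17, -4, 1:]"
    by (simp add: fps_of_poly_pCons numeral_fps_const[symmetric] fps_const_neg[symmetric] del: fps_const_neg)
      (simp add: eval_nat_numeral monom_Suc monom_0)
  show ?thesis
    unfolding A B recurrence_fps_def fps_of_poly_mult[symmetric] by (simp add: recurrence_def)
qed

lemma annihilated_recurrence:
  assumes "\<And>k. (\<Sum>i<15. recurrence ! i * a (k + i)) = 0"
  shows "annihilated recurrence_fps 14 (\<lambda>n. of_int (a n))"
proof (rule annihilated_palindromic)
  fix k
  have "(\<Sum>i\<le>14. recurrence_fps $ i * of_int (a (k + i))) = of_int (\<Sum>i<15. recurrence ! i * a (k
      + i))"
    unfolding of_int_sum by (intro sum.cong) (auto simp: recurrence_fps_nth)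
  then show "(\<Sum>i\<le>14. recurrence_fps $ i * of_int (a (k + i))) = 0" by (simp add: assms)
qed (use recurrence_palindromic in \<open>auto simp: recurrence_fps_nth\<close>)

lemma recurrence_fps_coeff_13: "(recurrence_fps * Abs_fps (\<lambda>n. of_int (a n))) $ 13
    = of_int (\<Sum>i<14. tail_coeffs ! i * a i)"
proof -
  have tail: "tail_coeffs ! (13 - i) = recurrence ! i" if "i \<le> 13" for i using tail_coeffs_nth[of
      "13 - i"] that by simp
  have "(recurrence_fps * Abs_fps (\<lambda>n. of_int (a n))) $ 13
      = (\<Sum>i\<le>13. recurrence_fps $ i * of_int (a (13 - i)))"
    by (simp add: fps_mult_nth atLeast0AtMost)
  also have "\<dots> = (\<Sum>i<14. of_int (tail_coeffs ! i * a i))"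
    by (rule sum.reindex_bij_witness[of _ "\<lambda>i. 13 - i" "\<lambda>i. 13 - i"])
      (auto simp: recurrence_fps_nth tail)
  finally show ?thesis by simp
qed

theorem theorem6p2p3:
  shows "\<exists>M :: rat poly. degree M = 29 \<and>
    Abs_fps (\<lambda>m. of_nat (total_leaves (graph_power (path_graph (m + 6)) 4))) =
      fps_of_poly M /
      ((fps_X ^ 6 - 3 * fps_X ^ 5 + 6 * fps_X ^ 4 - 10 * fps_X ^ 3 + 6 * fps_X ^ 2
          - 3 * fps_X + 1) ^ 2 *
       (fps_X ^ 8 - 4 * fps_X ^ 7 - 17 * fps_X ^ 6 + 8 * fps_X ^ 5 + 49 * fps_X ^ 4
          + 8 * fps_X ^ 3 - 17 * fps_X ^ 2 - 4 * fps_X + 1) ^ 2)"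
proof -
  define L where "L = (\<lambda>m. rat_of_nat (total_leaves (graph_power (path_graph (m + 6)) 4)))"
  define Bseries where "Bseries = Abs_fps (\<lambda>m. rat_of_int (boundary_count m))"
  define Cseries where "Cseries = diag (\<lambda>i j. rat_of_int (inner_count i j))"
  define E where "E = fps_const (L 0) + fps_const (L 1) * fps_X"
  have L_Suc: "L (m + 2) = of_int (boundary_count m)
      + 8 * (\<Sum>i<m. of_int (inner_count i (m - 1 - i)))" for m
  proof -
    have n: "m + 2 + 6 = m + 8" by simp
    have "L (m + 2) = of_int (int (total_leaves (graph_power (path_graph (m + 8)) 4)))"
      unfolding L_def n by simp
    then show ?thesis unfolding total_leaves_split by simp
  qed
  have decomposition: "Abs_fps L = E + fps_X ^ 2 * Bseries + fps_const 8 * (fps_X ^ 3 * Cseries)"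
  proof (rule fps_ext)
    fix n :: nat
    consider "n = 0" | "n = 1" | m where "n = m + 2"
    proof (cases "n < 2")
      case True
      then show ?thesis using that(1,2) by (auto simp: less_2_cases_iff)
    next
      case False
      then show ?thesis using that(3)[of "n - 2"] by simp
    qed
    then show "Abs_fps L $ n = (E + fps_X ^ 2 * Bseries + fps_const 8 * (fps_X ^ 3 * Cseries)) $ n"
    proof cases
      case 3
      have "(\<Sum>i<m. rat_of_int (inner_count i (m - 1 - i)))
          = (if m < 1 then 0 else Cseries $ (m - 1))"
        by (cases m) (auto simp: Cseries_def diag_def lessThan_Suc_atMost)
      then show ?thesis
        using L_Suc[of m] 3 by (auto simp: E_def Bseries_def fps_X_power_mult_nth)
    qed (auto simp: E_def fps_X_power_mult_nth)
  qed
  have Q0: "recurrence_fps $ n = 0" if "n > 14" for n using that by (simp add: recurrence_fps_nth)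
  have Q14: "recurrence_fps $ 14 = 1" by (simp add: recurrence_fps_nth recurrence_def)
  have QQ: "n > 28 \<Longrightarrow> (recurrence_fps * recurrence_fps) $ n = 0"
      "(recurrence_fps * recurrence_fps) $ 28 = 1" for n
    using fps_mult_vanish[of 14 recurrence_fps 14 recurrence_fps] Q0 Q14 by simp_all
  have E: "n > 29 \<Longrightarrow> (recurrence_fps * recurrence_fps * E) $ n = 0"
      "(recurrence_fps * recurrence_fps * E) $ 29 = L 1" for n
    using fps_mult_vanish[of 28 "recurrence_fps * recurrence_fps" 1 E] QQ by (simp_all add: E_def)
  have B13: "n > 13 \<Longrightarrow> (recurrence_fps * Bseries) $ n = 0" for n
    using annihilated_recurrence[OF recurrence_boundary] by (simp add: annihilated_def Bseries_def)
  have B: "n > 27 \<Longrightarrow> (recurrence_fps * recurrence_fps * Bseries) $ n = 0"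
    "(recurrence_fps * recurrence_fps * Bseries) $ 27
        = of_int (\<Sum>i<14. tail_coeffs ! i * boundary_count i)" for n
    using fps_mult_vanish[of 14 recurrence_fps 13 "recurrence_fps * Bseries"] Q0 Q14 B13
    by (simp_all add: mult.assoc recurrence_fps_coeff_13 Bseries_def)
  have C: "n > 26 \<Longrightarrow> (recurrence_fps * recurrence_fps * Cseries) $ n = 0"
    "(recurrence_fps * recurrence_fps * Cseries) $ 26
        = of_int (\<Sum>i<14. tail_coeffs ! i * (\<Sum>j<14. tail_coeffs ! j * inner_count i j))" for n
  proof -
    note double = annihilated_double[of recurrence_fps 13 "\<lambda>i j. rat_of_int (inner_count i j)"]
    have *: "annihilated recurrence_fps (Suc 13) (\<lambda>j. rat_of_int (inner_count i j))"
      "annihilated recurrence_fps (Suc 13) (\<lambda>i. rat_of_int (inner_count i j))" for i j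
      using annihilated_recurrence[OF recurrence_inner_snd] annihilated_recurrence[OF recurrence_inner_fst] by simp_all
    show "n > 26 \<Longrightarrow> (recurrence_fps * recurrence_fps * Cseries) $ n = 0"
      using double(1)[OF *] by (simp add: Cseries_def mult.assoc)
    have "(recurrence_fps * recurrence_fps * Cseries) $ 26
        = (\<Sum>i\<le>13. recurrence_fps $ (13 - i) * (\<Sum>j\<le>13. recurrence_fps $ (13 - j) * of_int (inner_count i j)))"
      using double(2)[OF *] by (simp add: Cseries_def mult.assoc)
    also have "\<dots> = (\<Sum>i<14. of_int (tail_coeffs ! i) * (\<Sum>j<14. of_int (tail_coeffs ! j) * of_int (inner_count i j)))"
      using tail_coeffs_nth by (intro sum.cong arg_cong2[where f = "(*)"])
          (auto simp: recurrence_fps_nth)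
    finally show "(recurrence_fps * recurrence_fps * Cseries) $ 26
        = of_int (\<Sum>i<14. tail_coeffs ! i * (\<Sum>j<14. tail_coeffs ! j * inner_count i j))"
      by simp
  qed
  \<comment> \<open>The three products have degree at most 29, 27 and 26, before the shifts by 0, 2 and 3.\<close>
  have prod: "recurrence_fps * recurrence_fps * Abs_fps L = recurrence_fps * recurrence_fps * E
      + fps_X ^ 2 * (recurrence_fps * recurrence_fps * Bseries)
      + fps_const 8 * (fps_X ^ 3 * (recurrence_fps * recurrence_fps * Cseries))"
    unfolding decomposition by (simp add: algebra_simps)
  have "L 1 = of_int (int (total_leaves (graph_power (path_graph 7) 4)))" by (simp add: L_def)
  then have L1: "L 1 = of_int 18360" by (simp only: total_leaves_7)
  have "(recurrence_fps * recurrence_fps * Abs_fps L) $ 29 = of_int (18360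
      + (\<Sum>i<14. tail_coeffs ! i * boundary_count i) +
      8 * (\<Sum>i<14. tail_coeffs ! i * (\<Sum>j<14. tail_coeffs ! j * inner_count i j)))"
    unfolding prod by (simp add: E B C L1[simplified] fps_X_power_mult_nth del: of_int_sum)
  then have lead: "(recurrence_fps * recurrence_fps * Abs_fps L) $ 29 \<noteq> 0"
      unfolding leading_coefficient by simp
  have "(recurrence_fps * recurrence_fps * Abs_fps L) $ n = 0" if "n > 29" for n
    unfolding prod using that by (simp add: E B C fps_X_power_mult_nth)
  moreover have "recurrence_fps * recurrence_fps \<noteq> 0" using QQ(2) by auto
  ultimately have "\<exists>M. degree M = 29 \<and> Abs_fps L
      = fps_of_poly M / (recurrence_fps * recurrence_fps)"
    using lead by (intro fps_eq_poly_divide)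
  moreover have "(fps_X ^ 6 - 3 * fps_X ^ 5 + 6 * fps_X ^ 4 - 10 * fps_X ^ 3 + 6 * fps_X ^ 2
          - 3 * fps_X + 1) ^ 2 *
       (fps_X ^ 8 - 4 * fps_X ^ 7 - 17 * fps_X ^ 6 + 8 * fps_X ^ 5 + 49 * fps_X ^ 4
          + 8 * fps_X ^ 3 - 17 * fps_X ^ 2 - 4 * fps_X + 1) ^ 2 = recurrence_fps * recurrence_fps"
    unfolding denominator[symmetric] by (simp only: power2_eq_square mult_ac)
  ultimately show ?thesis by (simp only: L_def)
qed

end
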